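(* For a non-negative integer $n$ let $$b_{n^{\pm}}=(\sigma_2\sigma_1\sigma_3\sigma_2)^{\pm n}\,\sigma_2^{\pm 1}\,(\sigma_1\sigma_3)^{\mp n}\in B_4 ,$$ where the upper signs are taken together (giving $b_{n^+}$) and the lower signs are taken together (giving $b_{n^-}$). A braid $b\in B_4$ is interchanging and unital if and only if it is equal in $B_4$ to one of the braids $b_{n^{+}}$ or $b_{n^{-}}$ with $n\ge 0$.
   Context: $B_n$ is the braid group on $n$ strands with standard generators $\sigma_1,\dots,\sigma_{n-1}$. Braids are drawn from top to bottom, and a word read from left to right is drawn from top to bottom ("followed by" means placed below). Strands are named by their initial (top) positions. A sub-braid is obtained by deleting a subset of the strands. To double a strand of a braid is to replace it by two parallel untwisted copies of itself (the two edges of a flat ribbon). The permutation associated to a braid is the one its strands induce on the positions; $\sigma_i$ has permutation $(i\ \ i{+}1)$. For $x\in B_4$ define four braids in $B_6$: - $Lx$: $x$ performed on the first four strands (positions 1--4), followed by the six-strand braid obtained from $x$ by doubling its strands 1 and 2. - $Rx$: $x$ performed on the last four strands (positions 3--6), followed by the six-strand braid obtained from $x$ by doubling its strands 3 and 4. - $L'x$: the six-strand braid obtained from $x$ by doubling its strands 2 and 4, followed by $x$ performed on the last four positions 3--6. - $R'x$: the six-strand braid obtained from $x$ by doubling its strands 1 and 3, followed by $x$ performed on the first four positions 1--4. A braid $b\in B_4$ is an interchanging unital braid (is "interchanging and unital") if: its associated permutation is $(2~3)$; $Lb=Rb$ and $L'b=R'b$ in $B_6$; and deleting any one of the pairs of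 strands $(1,2)$, $(3,4)$, $(1,3)$, $(2,4)$ results in the two-strand identity braid. *)

theory Defs
  imports "HOL-Algebra.Group" "HOL-Combinatorics.Transposition"
begin

section \<open>The braid group on n strands\<close>

text \<open>The letter \<open>(True, i)\<close> stands for the Artin generator \<open>\<sigma>\<^sub>i\<close> and \<open>(False, i)\<close> for
  its inverse; positions and generators are numbered from 1.\<close>

type_synonym braid_word = "(bool \<times> nat) list"

definition braid_words :: "nat \<Rightarrow> braid_word set" where
  "braid_words n = lists (UNIV \<times> {1..<n})"

text \<open>Artin's presentation.\<close>

inductive braid_eq :: "nat \<Rightarrow> braid_word \<Rightarrow> braid_word \<Rightarrow> bool" for n where
  refl: "w \<in> braid_words n \<Longrightarrow> braid_eq n w w"
| sym: "braid_eq n u v \<Longrightarrow> braid_eq n v u"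
| trans: "braid_eq n u v \<Longrightarrow> braid_eq n v w \<Longrightarrow> braid_eq n u w"
| append: "braid_eq n u u' \<Longrightarrow> braid_eq n v v' \<Longrightarrow> braid_eq n (u @ v) (u' @ v')"
| cancel: "i \<in> {1..<n} \<Longrightarrow> braid_eq n [(s, i), (\<not> s, i)] []"
| far: "i \<in> {1..<n} \<Longrightarrow> j \<in> {1..<n} \<Longrightarrow> i + 2 \<le> j \<Longrightarrow>
    braid_eq n [(True, i), (True, j)] [(True, j), (True, i)]"
| braid: "i \<in> {1..<n} \<Longrightarrow> Suc i \<in> {1..<n} \<Longrightarrow>
    braid_eq n [(True, i), (True, Suc i), (True, i)] [(True, Suc i), (True, i), (True, Suc i)]"

definition braid_class :: "nat \<Rightarrow> braid_word \<Rightarrow> braid_word set" where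
  "braid_class n w = {v. braid_eq n w v}"

definition braid_group :: "nat \<Rightarrow> braid_word set monoid" where
  "braid_group n = \<lparr>carrier = braid_class n ` braid_words n,
     mult = (\<lambda>X Y. \<Union>u\<in>X. \<Union>v\<in>Y. braid_class n (u @ v)),
     one = braid_class n []\<rparr>"

definition sigma :: "nat \<Rightarrow> nat \<Rightarrow> braid_word set" where
  "sigma n i = braid_class n [(True, i)]"

text \<open>\<open>braid_lift m f\<close> is the map into \<open>braid_group m\<close> induced by a map \<open>f\<close> on words that
  respects braid equality.\<close>

definition braid_lift :: "nat \<Rightarrow> (braid_word \<Rightarrow> braid_word) \<Rightarrow> braid_word set \<Rightarrow> braid_word set" where
  "braid_lift m f X = (\<Union>w\<in>X. braid_class m (f w))"

section \<open>Operations on braids\<close>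

text \<open>The position at the bottom of the strand that starts at a given position at the top.\<close>

primrec word_perm :: "braid_word \<Rightarrow> nat \<Rightarrow> nat" where
  "word_perm [] = id"
| "word_perm (l # w) = word_perm w \<circ> transpose (snd l) (Suc (snd l))"

definition braid_perm :: "braid_word set \<Rightarrow> nat \<Rightarrow> nat" where
  "braid_perm X = the_elem (word_perm ` X)"

text \<open>The braid, performed on the strands in positions from \<open>k + 1\<close> on, as a braid with \<open>m\<close> strands.\<close>

definition shift_word :: "nat \<Rightarrow> braid_word \<Rightarrow> braid_word" where
  "shift_word k = map (\<lambda>(s, i). (s, i + k))"

definition braid_shift :: "nat \<Rightarrow> nat \<Rightarrow> braid_word set \<Rightarrow> braid_word set" where
  "braid_shift m k = braid_lift m (shift_word k)"

text \<open>The crossing (of sign \<open>s\<close>) of \<open>p\<close> parallel strands, in positions \<open>f, \<dots>, f + p - 1\<close>, with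
  \<open>q\<close> parallel strands in the next \<open>q\<close> positions. The \<open>p\<close> strands cross the \<open>q\<close> strands one after
  another, beginning with the rightmost one. It is empty if \<open>p = 0\<close> or \<open>q = 0\<close>.\<close>

definition block :: "bool \<Rightarrow> nat \<Rightarrow> nat \<Rightarrow> nat \<Rightarrow> braid_word" where
  "block s f p q = concat (map (\<lambda>a. map (\<lambda>t. (s, f + a + t)) [0..<q]) (rev [0..<p]))"

text \<open>Replacing the strand that starts at position \<open>i\<close> by \<open>c i\<close> untwisted parallel copies,
  where \<open>c i = 0\<close> means deleting it. Along the word, \<open>c\<close> is kept up to date as a function
  of the current position.\<close>

primrec cable_word :: "(nat \<Rightarrow> nat) \<Rightarrow> braid_word \<Rightarrow> braid_word" where
  "cable_word c [] = []"
| "cable_word c (l # w) =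
    (let i = snd l in
      block (fst l) (1 + (\<Sum>k=1..<i. c k)) (c i) (c (Suc i))
      @ cable_word (c \<circ> transpose i (Suc i)) w)"

definition braid_cable :: "nat \<Rightarrow> (nat \<Rightarrow> nat) \<Rightarrow> braid_word set \<Rightarrow> braid_word set" where
  "braid_cable n c = braid_lift (\<Sum>k=1..n. c k) (cable_word c)"

definition double_strands :: "nat \<Rightarrow> nat set \<Rightarrow> braid_word set \<Rightarrow> braid_word set" where
  "double_strands n S = braid_cable n (\<lambda>k. if k \<in> S then 2 else 1)"

definition delete_strands :: "nat \<Rightarrow> nat set \<Rightarrow> braid_word set \<Rightarrow> braid_word set" where
  "delete_strands n S = braid_cable n (\<lambda>k. if k \<in> S then 0 else 1)"

section \<open>Interchanging unital braids\<close>

definition braid_L :: "braid_word set \<Rightarrow> braid_word set" where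
  "braid_L x = braid_shift 6 0 x \<otimes>\<^bsub>braid_group 6\<^esub> double_strands 4 {1, 2} x"

definition braid_R :: "braid_word set \<Rightarrow> braid_word set" where
  "braid_R x = braid_shift 6 2 x \<otimes>\<^bsub>braid_group 6\<^esub> double_strands 4 {3, 4} x"

definition braid_L' :: "braid_word set \<Rightarrow> braid_word set" where
  "braid_L' x = double_strands 4 {2, 4} x \<otimes>\<^bsub>braid_group 6\<^esub> braid_shift 6 2 x"

definition braid_R' :: "braid_word set \<Rightarrow> braid_word set" where
  "braid_R' x = double_strands 4 {1, 3} x \<otimes>\<^bsub>braid_group 6\<^esub> braid_shift 6 0 x"

definition interchanging_unital :: "braid_word set \<Rightarrow> bool" where
  "interchanging_unital b \<longleftrightarrow>
     b \<in> carrier (braid_group 4) \<and>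
     braid_perm b = transpose 2 3 \<and>
     braid_L b = braid_R b \<and> braid_L' b = braid_R' b \<and>
     (\<forall>S \<in> {{1, 2}, {3, 4}, {1, 3}, {2, 4}}. delete_strands 4 S b = \<one>\<^bsub>braid_group 2\<^esub>)"

text \<open>\<open>std_braid 1 n\<close> and \<open>std_braid (-1) n\<close> are the braids with upper and with lower signs.\<close>

definition std_braid :: "int \<Rightarrow> nat \<Rightarrow> braid_word set" where
  "std_braid e n =
    (let s = sigma 4; G = braid_group 4 in
      ((s 2 \<otimes>\<^bsub>G\<^esub> s 1 \<otimes>\<^bsub>G\<^esub> s 3 \<otimes>\<^bsub>G\<^esub> s 2) [^]\<^bsub>G\<^esub> (e * int n))
      \<otimes>\<^bsub>G\<^esub> (s 2 [^]\<^bsub>G\<^esub> e)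
      \<otimes>\<^bsub>G\<^esub> ((s 1 \<otimes>\<^bsub>G\<^esub> s 3) [^]\<^bsub>G\<^esub> (- (e * int n))))"

section \<open>The operations are well defined\<close>

lemma braid_words_simps [simp]:
  "[] \<in> braid_words n"
  "l # w \<in> braid_words n \<longleftrightarrow> snd l \<in> {1..<n} \<and> w \<in> braid_words n"
  "u @ v \<in> braid_words n \<longleftrightarrow> u \<in> braid_words n \<and> v \<in> braid_words n"
  by (auto simp: braid_words_def mem_Times_iff)

lemma braid_words_iff: "w \<in> braid_words n \<longleftrightarrow> (\<forall>l\<in>set w. 1 \<le> snd l \<and> snd l < n)"
  by (auto simp: braid_words_def in_lists_conv_set mem_Times_iff)

lemma braid_eq_words: "braid_eq n u v \<Longrightarrow> u \<in> braid_words n \<and> v \<in> braid_words n"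
  by (induction rule: braid_eq.induct) auto

lemmas braid_eq_trans [trans] = braid_eq.trans

lemma braid_class_eq_iff:
  assumes "u \<in> braid_words n"
  shows "braid_class n u = braid_class n v \<longleftrightarrow> braid_eq n u v"
  using assms unfolding braid_class_def
  by (auto intro: braid_eq.refl braid_eq.sym braid_eq.trans)

lemma braid_class_self: "u \<in> braid_words n \<Longrightarrow> u \<in> braid_class n u"
  by (simp add: braid_class_def braid_eq.refl)

lemma braid_lift_class:
  assumes "\<And>u v. braid_eq n u v \<Longrightarrow> braid_eq m (f u) (f v)" and "w \<in> braid_words n"
  shows "braid_lift m f (braid_class n w) = braid_class m (f w)"
proof -
  have "braid_class m (f v) = braid_class m (f w)" if "v \<in> braid_class n w" for v
    using assms that braid_class_eq_iff braid_eq_words braid_class_def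
    by (metis mem_Collect_eq)
  then show ?thesis
    using braid_class_self[OF assms(2)] unfolding braid_lift_def by blast
qed

lemma braid_mult_class:
  assumes "u \<in> braid_words n" "v \<in> braid_words n"
  shows "braid_class n u \<otimes>\<^bsub>braid_group n\<^esub> braid_class n v = braid_class n (u @ v)"
proof -
  have "braid_class n (u' @ v') = braid_class n (u @ v)"
    if "u' \<in> braid_class n u" "v' \<in> braid_class n v" for u' v'
  proof -
    have "braid_eq n (u @ v) (u' @ v')"
      using that unfolding braid_class_def by (auto intro: braid_eq.append)
    then show ?thesis using assms by (simp add: braid_class_eq_iff[symmetric])
  qed
  then have "(\<Union>u'\<in>braid_class n u. \<Union>v'\<in>braid_class n v. braid_class n (u' @ v'))
      = (\<Union>u'\<in>braid_class n u. \<Union>v'\<in>braid_class n v. braid_class n (u @ v))" by simp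
  also have "\<dots> = braid_class n (u @ v)"
    using assms[THEN braid_class_self] by blast
  finally show ?thesis unfolding braid_group_def by simp
qed

definition inv_word :: "braid_word \<Rightarrow> braid_word" where
  "inv_word w = rev (map (\<lambda>(s, i). (\<not> s, i)) w)"

lemma inv_word_simps [simp]:
  "inv_word [] = []" "inv_word (l # w) = inv_word w @ [(\<not> fst l, snd l)]"
  "inv_word (u @ v) = inv_word v @ inv_word u" "inv_word (inv_word w) = w"
  by (auto simp: inv_word_def rev_map case_prod_beta intro!: map_idI)

lemma inv_word_words [simp]: "inv_word w \<in> braid_words n \<longleftrightarrow> w \<in> braid_words n"
  by (induction w) auto

lemma inv_word_right: "w \<in> braid_words n \<Longrightarrow> braid_eq n (w @ inv_word w) []"
proof (induction w)
  case Nil then show ?case by (simp add: braid_eq.refl)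
next
  case (Cons l w)
  then have w: "braid_eq n (w @ inv_word w) []" and l: "snd l \<in> {1..<n}" by auto
  have "braid_eq n ([l] @ (w @ inv_word w) @ [(\<not> fst l, snd l)]) ([l] @ [] @ [(\<not> fst l, snd l)])"
    by (intro braid_eq.append w braid_eq.refl) (use l in auto)
  also have "braid_eq n ([l] @ [] @ [(\<not> fst l, snd l)]) []"
    using braid_eq.cancel[OF l, of "fst l"] by simp
  finally show ?case by simp
qed

lemma inv_word_left: "w \<in> braid_words n \<Longrightarrow> braid_eq n (inv_word w @ w) []"
  using inv_word_right[of "inv_word w" n] by simp

lemma inv_word_cong:
  assumes "braid_eq n u v" shows "braid_eq n (inv_word u) (inv_word v)"
proof -
  have w: "u \<in> braid_words n" "v \<in> braid_words n" using braid_eq_words[OF assms] by auto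
  have "braid_eq n (inv_word u @ []) (inv_word u @ (v @ inv_word v))"
    using w by (intro braid_eq.append braid_eq.refl braid_eq.sym[OF inv_word_right]) auto
  also have "braid_eq n (inv_word u @ (v @ inv_word v)) (inv_word u @ (u @ inv_word v))"
    using w assms by (intro braid_eq.append braid_eq.refl braid_eq.sym[OF assms]) auto
  also have "braid_eq n (inv_word u @ (u @ inv_word v)) ([] @ inv_word v)"
    unfolding append_assoc[symmetric]
    using w by (intro braid_eq.append inv_word_left braid_eq.refl) auto
  finally show ?thesis by simp
qed

theorem braid_group_group: "group (braid_group n)"
proof (rule groupI)
  have c: "carrier (braid_group n) = braid_class n ` braid_words n"
    and o: "\<one>\<^bsub>braid_group n\<^esub> = braid_class n []" by (simp_all add: braid_group_def)
  show "x \<otimes>\<^bsub>braid_group n\<^esub> y \<in> carrier (braid_group n)"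
    if "x \<in> carrier (braid_group n)" "y \<in> carrier (braid_group n)" for x y
    using that unfolding c by (auto simp: braid_mult_class)
  show "\<one>\<^bsub>braid_group n\<^esub> \<in> carrier (braid_group n)" unfolding c o by auto
  show "x \<otimes>\<^bsub>braid_group n\<^esub> y \<otimes>\<^bsub>braid_group n\<^esub> z = x \<otimes>\<^bsub>braid_group n\<^esub> (y \<otimes>\<^bsub>braid_group n\<^esub> z)"
    if "x \<in> carrier (braid_group n)" "y \<in> carrier (braid_group n)" "z \<in> carrier (braid_group n)" for x y z
    using that unfolding c by (auto simp: braid_mult_class)
  show "\<one>\<^bsub>braid_group n\<^esub> \<otimes>\<^bsub>braid_group n\<^esub> x = x" if "x \<in> carrier (braid_group n)" for x
    using that unfolding c o by (auto simp: braid_mult_class)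
  show "\<exists>y\<in>carrier (braid_group n). y \<otimes>\<^bsub>braid_group n\<^esub> x = \<one>\<^bsub>braid_group n\<^esub>"
    if x: "x \<in> carrier (braid_group n)" for x
  proof -
    obtain w where w: "w \<in> braid_words n" "x = braid_class n w" using x unfolding c by blast
    then have "braid_class n (inv_word w) \<otimes>\<^bsub>braid_group n\<^esub> x = \<one>\<^bsub>braid_group n\<^esub>"
      using inv_word_left[OF w(1)] unfolding o by (simp add: braid_mult_class braid_class_eq_iff)
    then show ?thesis using w unfolding c by auto
  qed
qed

lemma word_perm_append: "word_perm (u @ v) = word_perm v \<circ> word_perm u"
  by (induction u) (auto simp: comp_assoc)

lemma transpose_far:
  "i + 2 \<le> j \<Longrightarrow>
    transpose i (Suc i) (transpose j (Suc j) k) = transpose j (Suc j) (transpose i (Suc i) k)"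
  unfolding transpose_def by (simp split: if_split)

lemma transpose_braid:
  "transpose i (Suc i) (transpose (Suc i) (Suc (Suc i)) (transpose i (Suc i) k))
    = transpose (Suc i) (Suc (Suc i)) (transpose i (Suc i) (transpose (Suc i) (Suc (Suc i)) k))"
proof (cases "k = i \<or> k = Suc i \<or> k = Suc (Suc i)")
  case True
  then show ?thesis by (elim disjE) (simp_all add: transpose_def)
next
  case False
  then show ?thesis by simp
qed

lemma word_perm_cong: "braid_eq n u v \<Longrightarrow> word_perm u = word_perm v"
proof (induction rule: braid_eq.induct)
  case (far i j) then show ?case
    by (intro ext) (simp, rule transpose_far[symmetric], simp)
next
  case (braid i) show ?case by (simp add: fun_eq_iff transpose_braid)
qed (simp_all add: word_perm_append)

lemma braid_perm_class:
  assumes "w \<in> braid_words n" shows "braid_perm (braid_class n w) = word_perm w"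
proof -
  have "word_perm ` braid_class n w = {word_perm w}"
  proof
    show "word_perm ` braid_class n w \<subseteq> {word_perm w}"
      using word_perm_cong by (auto simp: braid_class_def)
    show "{word_perm w} \<subseteq> word_perm ` braid_class n w"
      using braid_class_self[OF assms] by simp
  qed
  then show ?thesis by (simp add: braid_perm_def)
qed

lemma shift_word_append [simp]: "shift_word k (u @ v) = shift_word k u @ shift_word k v"
  by (simp add: shift_word_def)

lemma shift_word_words: "w \<in> braid_words n \<Longrightarrow> n + k \<le> m \<Longrightarrow> shift_word k w \<in> braid_words m"
  by (auto simp: braid_words_iff shift_word_def)

lemma shift_word_cong:
  assumes "n + k \<le> m"
  shows "braid_eq n u v \<Longrightarrow> braid_eq m (shift_word k u) (shift_word k v)"
proof (induction rule: braid_eq.induct)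
  case (refl w) then show ?case using assms by (intro braid_eq.refl shift_word_words)
next
  case (sym u v) show ?case by (rule braid_eq.sym[OF sym.IH])
next
  case (trans u v w) show ?case by (rule braid_eq.trans[OF trans.IH])
next
  case (append u u' v v') then show ?case by (simp add: braid_eq.append)
next
  case (cancel i s)
  then show ?case using assms braid_eq.cancel[of "i + k" m s] by (simp add: shift_word_def)
next
  case (far i j)
  then show ?case using assms braid_eq.far[of "i + k" m "j + k"] by (simp add: shift_word_def)
next
  case (braid i)
  then show ?case using assms braid_eq.braid[of "i + k" m] by (simp add: shift_word_def)
qed

theorem braid_shift_class:
  "w \<in> braid_words n \<Longrightarrow> n + k \<le> m \<Longrightarrow> braid_shift m k (braid_class n w) = braid_class m (shift_word k w)"
  unfolding braid_shift_def by (rule braid_lift_class[OF shift_word_cong])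

lemma letters_commute:
  assumes "i \<in> {1..<n}" "j \<in> {1..<n}" "i + 2 \<le> j \<or> j + 2 \<le> i"
  shows "braid_eq n [(s, i), (s, j)] [(s, j), (s, i)]"
proof -
  have *: "braid_eq n [(True, i), (True, j)] [(True, j), (True, i)]"
    if "i \<in> {1..<n}" "j \<in> {1..<n}" "i + 2 \<le> j \<or> j + 2 \<le> i" for i j
    using that braid_eq.far braid_eq.sym by blast
  show ?thesis
    using *[OF assms] inv_word_cong[OF *[of j i]] assms by (cases s) auto
qed

lemma letter_word_commute:
  assumes "i \<in> {1..<n}" "w \<in> braid_words n"
    and "\<forall>l\<in>set w. fst l = s \<and> (i + 2 \<le> snd l \<or> snd l + 2 \<le> i)"
  shows "braid_eq n ([(s, i)] @ w) (w @ [(s, i)])"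
  using assms(2,3)
proof (induction w)
  case Nil then show ?case using assms(1) by (simp add: braid_eq.refl)
next
  case (Cons l w)
  obtain j where l: "l = (s, j)" using Cons.prems by (cases l) auto
  have IH: "braid_eq n ([(s, i)] @ w) (w @ [(s, i)])" using Cons by auto
  have "braid_eq n ([(s, i), (s, j)] @ w) ([(s, j), (s, i)] @ w)"
    using Cons.prems assms(1) l by (intro braid_eq.append letters_commute braid_eq.refl) auto
  also have "[(s, j), (s, i)] @ w = [(s, j)] @ [(s, i)] @ w" by simp
  also have "braid_eq n ([(s, j)] @ [(s, i)] @ w) ([(s, j)] @ w @ [(s, i)])"
    using Cons.prems l by (intro braid_eq.append IH braid_eq.refl) auto
  finally show ?case using l by simp
qed

lemma words_commute:
  assumes "u \<in> braid_words n" "w \<in> braid_words n"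
    and "\<forall>k\<in>set u. \<forall>l\<in>set w. fst k = s \<and> fst l = s \<and> (snd k + 2 \<le> snd l \<or> snd l + 2 \<le> snd k)"
  shows "braid_eq n (u @ w) (w @ u)"
  using assms(1,3)
proof (induction u)
  case Nil then show ?case using assms(2) by (simp add: braid_eq.refl)
next
  case (Cons k u)
  show ?case
  proof (cases "w = []")
    case True then show ?thesis using Cons.prems by (auto intro: braid_eq.refl)
  next
    case False
    then obtain i where k: "k = (s, i)" using Cons.prems by (cases k; cases w) auto
    have "braid_eq n ([k] @ (u @ w)) ([k] @ (w @ u))"
      using Cons assms(2) by (intro braid_eq.append braid_eq.refl Cons.IH) auto
    also have "[k] @ (w @ u) = ([k] @ w) @ u" by simp
    also have "braid_eq n (([k] @ w) @ u) ((w @ [k]) @ u)"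
      unfolding k using Cons.prems assms(2) k
      by (intro braid_eq.append braid_eq.refl letter_word_commute) auto
    finally show ?thesis by simp
  qed
qed

definition row :: "bool \<Rightarrow> nat \<Rightarrow> nat \<Rightarrow> braid_word" where
  "row s f q = map (\<lambda>t. (s, f + t)) [0..<q]"

lemma block_0 [simp]: "block s f 0 q = []"
  by (simp add: block_def)

lemma block_Suc: "block s f (Suc p) q = row s (f + p) q @ block s f p q"
  by (simp add: block_def row_def)

lemma set_row: "set (row s f q) = (\<lambda>t. (s, f + t)) ` {..<q}"
  by (auto simp: row_def)

lemma set_block: "set (block s f p q) = (\<lambda>(a, t). (s, f + a + t)) ` ({..<p} \<times> {..<q})"
  by (auto simp: block_def)

lemma block_words: "1 \<le> f \<Longrightarrow> f + p + q \<le> Suc n \<Longrightarrow> block s f p q \<in> braid_words n"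
  by (auto simp: braid_words_iff set_block)

lemma row_words: "1 \<le> f \<Longrightarrow> f + q \<le> n \<Longrightarrow> row s f q \<in> braid_words n"
  by (auto simp: braid_words_iff set_row)

lemma row_add: "row s f (q + r) = row s f q @ row s (f + q) r"
  by (rule nth_equalityI) (auto simp: row_def nth_append)

definition colblock :: "bool \<Rightarrow> nat \<Rightarrow> nat \<Rightarrow> nat \<Rightarrow> braid_word" where
  "colblock s f p q = concat (map (\<lambda>t. map (\<lambda>a. (s, f + a + t)) (rev [0..<p])) [0..<q])"

lemma set_colblock: "set (colblock s f p q) = (\<lambda>(a, t). (s, f + a + t)) ` ({..<p} \<times> {..<q})"
  by (auto simp: colblock_def)

lemma colblock_words: "1 \<le> f \<Longrightarrow> f + p + q \<le> Suc n \<Longrightarrow> colblock s f p q \<in> braid_words n"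
  by (auto simp: braid_words_iff set_colblock)

lemma colblock_Suc:
  "colblock s f p (Suc q) = colblock s f p q @ map (\<lambda>a. (s, f + a + q)) (rev [0..<p])"
  by (simp add: colblock_def)

lemma row_colblock:
  "1 \<le> f \<Longrightarrow> f + Suc p + q \<le> Suc n \<Longrightarrow>
    braid_eq n (row s (f + p) q @ colblock s f p q) (colblock s f (Suc p) q)"
proof (induction q)
  case 0 then show ?case by (auto simp: row_def colblock_def intro: braid_eq.refl)
next
  case (Suc q)
  let ?x = "(s, f + p + q)" and ?c = "map (\<lambda>a. (s, f + a + q)) (rev [0..<p])"
  have IH: "braid_eq n (row s (f + p) q @ colblock s f p q) (colblock s f (Suc p) q)"
    using Suc by auto
  have c: "?c \<in> braid_words n" using Suc.prems by (auto simp: braid_words_iff)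
  have "row s (f + p) (Suc q) @ colblock s f p (Suc q)
      = row s (f + p) q @ ([?x] @ colblock s f p q) @ ?c"
    by (simp add: row_def colblock_Suc)
  also have "braid_eq n \<dots> (row s (f + p) q @ (colblock s f p q @ [?x]) @ ?c)"
    using Suc.prems c
    by (intro braid_eq.append braid_eq.refl letter_word_commute colblock_words row_words)
      (auto simp: set_colblock)
  also have "\<dots> = (row s (f + p) q @ colblock s f p q) @ ([?x] @ ?c)" by simp
  also have "braid_eq n \<dots> (colblock s f (Suc p) q @ ([?x] @ ?c))"
    using Suc.prems c by (intro braid_eq.append IH braid_eq.refl) auto
  also have "\<dots> = colblock s f (Suc p) (Suc q)" by (simp add: colblock_Suc)
  finally show ?case .
qed

lemma block_colblock:
  "1 \<le> f \<Longrightarrow> f + p + q \<le> Suc n \<Longrightarrow> braid_eq n (block s f p q) (colblock s f p q)"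
proof (induction p)
  case 0 then show ?case by (auto simp: colblock_def concat_eq_Nil_conv[THEN iffD2] intro: braid_eq.refl)
next
  case (Suc p)
  then have IH: "braid_eq n (block s f p q) (colblock s f p q)" by auto
  have "braid_eq n (row s (f + p) q @ block s f p q) (row s (f + p) q @ colblock s f p q)"
    using Suc.prems by (intro braid_eq.append IH braid_eq.refl row_words) auto
  also have "braid_eq n \<dots> (colblock s f (Suc p) q)" using Suc.prems by (intro row_colblock) auto
  finally show ?case by (simp add: block_Suc)
qed

lemma inv_word_block: "inv_word (block s f p q) = colblock (\<not> s) f q p"
  by (simp add: inv_word_def block_def colblock_def rev_concat map_concat rev_map comp_def ac_simps)

lemma block_cancel:
  assumes "1 \<le> f" "f + p + q \<le> Suc n"
  shows "braid_eq n (block s f p q @ block (\<not> s) f q p) []"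
proof -
  have "braid_eq n (block s f p q @ block (\<not> s) f q p) (block s f p q @ inv_word (block s f p q))"
    unfolding inv_word_block
    using assms by (intro braid_eq.append braid_eq.refl block_words block_colblock) auto
  also have "braid_eq n \<dots> []" using assms by (intro inv_word_right block_words)
  finally show ?thesis .
qed

lemma block_split:
  "1 \<le> f \<Longrightarrow> f + p + q + r \<le> Suc n \<Longrightarrow>
    braid_eq n (block s f p q @ block s (f + q) p r) (block s f p (q + r))"
proof (induction p)
  case 0 then show ?case by (simp add: braid_eq.refl)
next
  case (Suc p)
  let ?a = "row s (f + p) q" and ?b = "row s (f + p + q) r"
  have IH: "braid_eq n (block s f p q @ block s (f + q) p r) (block s f p (q + r))"
    using Suc by auto
  have ab: "?a \<in> braid_words n" "?b \<in> braid_words n" using Suc.prems by (auto intro: row_words)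
  have "block s f (Suc p) q @ block s (f + q) (Suc p) r
      = ?a @ (block s f p q @ ?b) @ block s (f + q) p r" by (simp add: block_Suc ac_simps)
  also have "braid_eq n \<dots> (?a @ (?b @ block s f p q) @ block s (f + q) p r)"
    using Suc.prems ab
    by (intro braid_eq.append braid_eq.refl words_commute[where s = s] block_words)
      (auto simp: set_block set_row)
  also have "\<dots> = (?a @ ?b) @ (block s f p q @ block s (f + q) p r)" by simp
  also have "braid_eq n \<dots> ((?a @ ?b) @ block s f p (q + r))"
    using ab by (intro braid_eq.append IH braid_eq.refl) auto
  also have "\<dots> = block s f (Suc p) (q + r)" by (simp add: block_Suc row_add)
  finally show ?case .
qed

lemma row_slide:
  assumes "1 \<le> f" "f + m \<le> n" "f \<le> k" "k + 2 \<le> f + m"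
  shows "braid_eq n ([(True, Suc k)] @ row True f m) (row True f m @ [(True, k)])"
proof -
  define a b where "a = row True f (k - f)" and "b = row True (k + 2) (f + m - (k + 2))"
  have "m = (k - f) + (2 + (f + m - (k + 2)))" using assms by auto
  then have "row True f m = row True f ((k - f) + (2 + (f + m - (k + 2))))" by (rule arg_cong)
  also have "\<dots> = a @ [(True, k), (True, Suc k)] @ b"
    unfolding row_add a_def b_def using assms by (simp add: row_def numeral_2_eq_2)
  finally have row: "row True f m = a @ [(True, k), (True, Suc k)] @ b" .
  have ab: "a \<in> braid_words n" "b \<in> braid_words n"
    unfolding a_def b_def using assms by (auto intro: row_words)
  have "[(True, Suc k)] @ row True f m = ([(True, Suc k)] @ a) @ [(True, k), (True, Suc k)] @ b"
    by (simp add: row)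
  also have "braid_eq n \<dots> ((a @ [(True, Suc k)]) @ [(True, k), (True, Suc k)] @ b)"
    using assms ab
    by (intro braid_eq.append braid_eq.refl letter_word_commute) (auto simp: a_def set_row)
  also have "\<dots> = a @ [(True, Suc k), (True, k), (True, Suc k)] @ b" by simp
  also have "braid_eq n \<dots> (a @ [(True, k), (True, Suc k), (True, k)] @ b)"
    using assms ab by (intro braid_eq.append braid_eq.refl braid_eq.sym[OF braid_eq.braid]) auto
  also have "\<dots> = a @ [(True, k), (True, Suc k)] @ ([(True, k)] @ b)" by simp
  also have "braid_eq n \<dots> (a @ [(True, k), (True, Suc k)] @ (b @ [(True, k)]))"
    using assms ab
    by (intro braid_eq.append braid_eq.refl letter_word_commute) (auto simp: b_def set_row)
  also have "\<dots> = row True f m @ [(True, k)]" by (simp add: row)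
  finally show ?thesis .
qed

lemma block_slide:
  assumes "1 \<le> f" "f \<le> k" "k + 2 \<le> f + m"
  shows "f + p + m \<le> Suc n \<Longrightarrow> 
    braid_eq n ([(True, k + p)] @ block True f p m) (block True f p m @ [(True, k)])"
proof (induction p)
  case 0 then show ?case using assms by (auto intro!: braid_eq.refl)
next
  case (Suc p)
  let ?r = "row True (f + p) m"
  have IH: "braid_eq n ([(True, k + p)] @ block True f p m) (block True f p m @ [(True, k)])"
    using Suc by auto
  have "[(True, k + Suc p)] @ block True f (Suc p) m = ([(True, Suc (k + p))] @ ?r) @ block True f p m"
    by (simp add: block_Suc)
  also have "braid_eq n \<dots> ((?r @ [(True, k + p)]) @ block True f p m)"
    using assms Suc.prems by (intro braid_eq.append row_slide braid_eq.refl block_words) auto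
  also have "\<dots> = ?r @ ([(True, k + p)] @ block True f p m)" by simp
  also have "braid_eq n \<dots> (?r @ (block True f p m @ [(True, k)]))"
    using assms Suc.prems by (intro braid_eq.append IH braid_eq.refl row_words) auto
  also have "\<dots> = block True f (Suc p) m @ [(True, k)]" by (simp add: block_Suc)
  finally show ?case .
qed

lemma block_slide_word:
  assumes "1 \<le> f" "f + p + m \<le> Suc n"
  shows "\<forall>l\<in>set w. fst l \<and> f \<le> snd l \<and> snd l + 2 \<le> f + m \<Longrightarrow> 
    braid_eq n (shift_word p w @ block True f p m) (block True f p m @ w)"
proof (induction w)
  case Nil then show ?case using braid_eq.refl[OF block_words[OF assms]] by (simp add: shift_word_def)
next
  case (Cons l w)
  obtain k where l: "l = (True, k)" using Cons.prems by (cases l) auto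
  have IH: "braid_eq n (shift_word p w @ block True f p m) (block True f p m @ w)" using Cons by auto
  show ?case
  proof (cases "p = 0")
    case True
    have "l # w \<in> braid_words n" using assms Cons.prems by (fastforce simp: braid_words_iff)
    then show ?thesis using True by (auto simp: shift_word_def intro!: braid_eq.refl)
  next
    case False
    have "shift_word p (l # w) @ block True f p m
        = [(True, k + p)] @ (shift_word p w @ block True f p m)" by (simp add: l shift_word_def)
    also have "braid_eq n \<dots> ([(True, k + p)] @ (block True f p m @ w))"
      using assms Cons.prems l by (intro braid_eq.append IH braid_eq.refl) auto
    also have "\<dots> = ([(True, k + p)] @ block True f p m) @ w" by simp
    also have "braid_eq n \<dots> ((block True f p m @ [(True, k)]) @ w)"
      using assms Cons.prems l braid_eq_words[OF IH]
      by (intro braid_eq.append block_slide braid_eq.refl) auto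
    finally show ?thesis by (simp add: l)
  qed
qed

lemma block_braid:
  assumes "1 \<le> f" "f + p + q + r \<le> Suc n"
  shows "braid_eq n (block True f p q @ block True (f + q) p r @ block True f q r)
    (block True (f + p) q r @ block True f p r @ block True (f + r) p q)"
proof -
  have sh: "block True (f + p) q r = shift_word p (block True f q r)"
    by (simp add: shift_word_def block_def map_concat comp_def ac_simps)
  have "braid_eq n ((block True f p q @ block True (f + q) p r) @ block True f q r)
      (block True f p (q + r) @ block True f q r)"
    using assms by (intro braid_eq.append block_split braid_eq.refl block_words) auto
  also have "braid_eq n \<dots> (shift_word p (block True f q r) @ block True f p (q + r))"
    using assms by (intro braid_eq.sym[OF block_slide_word]) (auto simp: set_block)
  also have "\<dots> = block True (f + p) q r @ block True f p (r + q)" by (simp add: sh ac_simps)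
  also have "braid_eq n \<dots> (block True (f + p) q r @ (block True f p r @ block True (f + r) p q))"
    using assms by (intro braid_eq.append braid_eq.sym[OF block_split] braid_eq.refl block_words) auto
  finally show ?thesis by simp
qed

primrec relabel :: "(nat \<Rightarrow> nat) \<Rightarrow> braid_word \<Rightarrow> nat \<Rightarrow> nat" where
  "relabel c [] = c"
| "relabel c (l # w) = relabel (c \<circ> transpose (snd l) (Suc (snd l))) w"

lemma relabel_append: "relabel c (u @ v) = relabel (relabel c u) v"
  by (induction u arbitrary: c) auto

lemma cable_word_append: "cable_word c (u @ v) = cable_word c u @ cable_word (relabel c u) v"
  by (induction u arbitrary: c) (auto simp: Let_def)

lemma relabel_cong: "braid_eq n u v \<Longrightarrow> relabel c u = relabel c v"
proof (induction arbitrary: c rule: braid_eq.induct)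
  case (far i j) then show ?case
    by (intro ext) (simp, rule arg_cong[where f = c], rule transpose_far, simp)
next
  case (braid i) show ?case by (simp add: fun_eq_iff transpose_braid)
qed (simp_all add: relabel_append comp_assoc)

lemma sum_transpose:
  assumes "i \<in> {1..<n}"
  shows "(\<Sum>k=1..n. (c \<circ> transpose i (Suc i)) k) = (\<Sum>k=1..n. (c k :: nat))"
proof (rule sum.reindex_bij_betw[of "transpose i (Suc i)" "{1..n}" "{1..n}" c, unfolded comp_def[symmetric]])
  show "bij_betw (transpose i (Suc i)) {1..n} {1..n}"
    using assms by (intro bij_betw_byWitness[of _ "transpose i (Suc i)"]) (auto simp: transpose_def)
qed

lemma sum_relabel:
  "w \<in> braid_words n \<Longrightarrow> (\<Sum>k=1..n. relabel c w k) = (\<Sum>k=1..n. c k)"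
proof (induction w arbitrary: c)
  case (Cons l w)
  then show ?case using sum_transpose[of "snd l" n c] by simp
qed simp

lemma sum_split:
  assumes "1 \<le> i"
  shows "(\<Sum>k=1..<Suc i. (c k :: nat)) = (\<Sum>k=1..<i. c k) + c i"
  using assms by simp

lemma sum_bound:
  assumes "j \<le> Suc n" shows "(\<Sum>k=1..<j. (c k :: nat)) \<le> (\<Sum>k=1..n. c k)"
  using assms by (intro sum_mono2) auto

lemma cable_word_words:
  "w \<in> braid_words n \<Longrightarrow> cable_word c w \<in> braid_words (\<Sum>k=1..n. c k)"
proof (induction w arbitrary: c)
  case (Cons l w)
  let ?i = "snd l"
  have i: "1 \<le> ?i" "Suc (Suc ?i) \<le> Suc n" using Cons.prems by auto
  have "block (fst l) (1 + (\<Sum>k=1..<?i. c k)) (c ?i) (c (Suc ?i)) \<in> braid_words (\<Sum>k=1..n. c k)"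
    using sum_bound[OF i(2), of c] i(1) by (intro block_words) auto
  moreover have "cable_word (c \<circ> transpose ?i (Suc ?i)) w \<in> braid_words (\<Sum>k=1..n. c k)"
    using Cons.IH[of "c \<circ> transpose ?i (Suc ?i)"] Cons.prems sum_transpose[of ?i n c]
    by (simp del: o_apply only: braid_words_simps)
  ultimately show ?case by (simp add: Let_def del: o_apply)
qed simp

lemma sum_transpose_below:
  "j \<le> i \<Longrightarrow> (\<Sum>k=1..<j. c (transpose i (Suc i) k)) = (\<Sum>k=1..<j. (c k :: nat))"
  by (intro sum.cong) (auto simp: transpose_def)

lemma sum_transpose_above:
  assumes "1 \<le> i" "i + 2 \<le> j"
  shows "(\<Sum>k=1..<j. c (transpose i (Suc i) k)) = (\<Sum>k=1..<j. (c k :: nat))"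
proof -
  have "{1..<j} = {1..j - 1}" using assms by auto
  then show ?thesis using sum_transpose[of i "j - 1" c] assms by simp
qed

theorem cable_word_cong:
  "braid_eq n u v \<Longrightarrow> braid_eq (\<Sum>k=1..n. c k) (cable_word c u) (cable_word c v)"
proof (induction arbitrary: c rule: braid_eq.induct)
  case (refl w) then show ?case by (intro braid_eq.refl cable_word_words)
next
  case (sym u v) then show ?case by (blast intro: braid_eq.sym)
next
  case (trans u v w) then show ?case by (blast intro: braid_eq.trans)
next
  case (append u u' v v')
  have "braid_eq (\<Sum>k=1..n. c k) (cable_word (relabel c u) v) (cable_word (relabel c u) v')"
    using append.IH(2)[of "relabel c u"] sum_relabel braid_eq_words[OF append.hyps(1)] by simp
  then show ?case
    using append.IH(1)[of c] relabel_cong[OF append.hyps(1), of c]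
    by (simp add: cable_word_append braid_eq.append)
next
  case (cancel i s)
  let ?f = "1 + (\<Sum>k=1..<i. c k)"
  have "braid_eq (\<Sum>k=1..n. c k) (block s ?f (c i) (c (Suc i)) @ block (\<not> s) ?f (c (Suc i)) (c i)) []"
    using sum_bound[of "Suc (Suc i)" n c] cancel by (intro block_cancel) auto
  then show ?case by (simp add: Let_def sum_transpose_below)
next
  case (far i j)
  let ?f = "1 + (\<Sum>k=1..<i. c k)" and ?g = "1 + (\<Sum>k=1..<j. c k)"
  have le: "?f + c i + c (Suc i) \<le> ?g"
  proof -
    have "{1..j - 1} = {1..<j}" using far by auto
    then show ?thesis using far sum_bound[of "Suc (Suc i)" "j - 1" c] by simp
  qed
  have "braid_eq (\<Sum>k=1..n. c k)
     (block True ?f (c i) (c (Suc i)) @ block True ?g (c j) (c (Suc j)))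
     (block True ?g (c j) (c (Suc j)) @ block True ?f (c i) (c (Suc i)))"
    using far le sum_bound[of "Suc (Suc j)" n c] sum_bound[of "Suc (Suc i)" n c]
    by (intro words_commute[where s = True] block_words) (auto simp: set_block)
  then show ?case
    using far by (simp add: Let_def sum_transpose_below sum_transpose_above[unfolded One_nat_def])
next
  case (braid i)
  let ?f = "1 + (\<Sum>k=1..<i. c k)"
  have *: "braid_eq (\<Sum>k=1..n. c k)
    (block True ?f (c i) (c (Suc i)) @ block True (?f + c (Suc i)) (c i) (c (Suc (Suc i)))
      @ block True ?f (c (Suc i)) (c (Suc (Suc i))))
    (block True (?f + c i) (c (Suc i)) (c (Suc (Suc i))) @ block True ?f (c i) (c (Suc (Suc i)))
      @ block True (?f + c (Suc (Suc i))) (c i) (c (Suc i)))"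
    using braid sum_bound[of "Suc (Suc (Suc i))" n c] by (intro block_braid) auto
  have t: "transpose i (Suc i) (Suc (Suc i)) = Suc (Suc i)"
    "transpose (Suc i) (Suc (Suc i)) i = i" by (auto simp: transpose_def)
  let ?T = "transpose i (Suc i)" and ?U = "transpose (Suc i) (Suc (Suc i))"
  have b: "(\<Sum>k = Suc 0..<i. c (?T k)) = sum c {Suc 0..<i}"
    "(\<Sum>k = Suc 0..<i. c (?U k)) = sum c {Suc 0..<i}"
    "(\<Sum>k = Suc 0..<i. c (?U (?T k))) = sum c {Suc 0..<i}"
    "(\<Sum>k = Suc 0..<i. c (?T (?U k))) = sum c {Suc 0..<i}"
    by (intro sum.cong refl; simp add: transpose_def)+
  have L: "cable_word c [(True, i), (True, Suc i), (True, i)] =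
    block True ?f (c i) (c (Suc i)) @ block True (?f + c (Suc i)) (c i) (c (Suc (Suc i)))
      @ block True ?f (c (Suc i)) (c (Suc (Suc i)))"
    using braid.hyps(1) by (simp add: Let_def t b)
  have R: "cable_word c [(True, Suc i), (True, i), (True, Suc i)] =
    block True (?f + c i) (c (Suc i)) (c (Suc (Suc i))) @ block True ?f (c i) (c (Suc (Suc i)))
      @ block True (?f + c (Suc (Suc i))) (c i) (c (Suc i))"
    using braid.hyps(1) by (simp add: Let_def t b)
  show ?case unfolding L R by (rule *)
qed

theorem braid_cable_class:
  "w \<in> braid_words n \<Longrightarrow>
    braid_cable n c (braid_class n w) = braid_class (\<Sum>k=1..n. c k) (cable_word c w)"
  unfolding braid_cable_def by (rule braid_lift_class[OF cable_word_cong])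

end

theory Submission
  imports Defs
begin

text \<open>
  Read the defining equations as coherence conditions for an interchange
  \<open>b : (A B)(C D) \<rightarrow> (A C)(B D)\<close> in a braided monoidal category. Write \<open>[abcd]\<close> for
  \<open>b\<close> with its strands replaced by \<open>a, b, c, d\<close> parallel copies. The remaining two-strand braids
  \<open>[1001]\<close> and \<open>[0110]\<close> are powers \<open>\<sigma>\<^sub>1\<^sup>p\<close> and \<open>\<sigma>\<^sub>1\<^sup>q\<close>, with \<open>p\<close> even and \<open>q\<close> odd. Deleting
  strands in \<open>L b = R b\<close> and \<open>L' b = R' b\<close> expresses first \<open>[1011]\<close>, \<open>[1110]\<close>, \<open>[0111]\<close> and then
  \<open>b = [1111]\<close> by these two, so that \<open>b\<close> is determined by \<open>(p, q)\<close>. Moreover \<open>[1110]\<close> and \<open>[1011]\<close>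
  are tied by a relation in \<open>B\<^sub>3\<close>, whose image in \<open>SL\<^sub>2(\<int>)\<close> forces \<open>p - q = \<plusminus> 1\<close>.
  Conversely, if \<open>b\<close> is interchanging and unital then so is
  \<open>(\<sigma>\<^sub>2 \<sigma>\<^sub>1 \<sigma>\<^sub>3 \<sigma>\<^sub>2) b (\<sigma>\<^sub>1 \<sigma>\<^sub>3)\<^sup>-\<^sup>1\<close>, by naturality of the braiding, and this operation takes
  \<open>(p, q)\<close> to \<open>(q + 1, p + 1)\<close>. Starting from \<open>\<sigma>\<^sub>2\<close>, and up to mirror images, all pairs with \<open>p\<close> even
  and \<open>p - q = \<plusminus> 1\<close> are reached.
\<close>

section \<open>Rewriting modulo braid equality\<close>

lemma braid_eq_context:
  "braid_eq n u v \<Longrightarrow> a \<in> braid_words n \<Longrightarrow> b \<in> braid_words n \<Longrightarrow> braid_eq n (a @ u @ b) (a @ v @ b)"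
  by (intro braid_eq.append braid_eq.refl)

lemma braid_eq_appendL:
  "braid_eq n u v \<Longrightarrow> a \<in> braid_words n \<Longrightarrow> braid_eq n (a @ u) (a @ v)"
  by (intro braid_eq.append braid_eq.refl)

lemma braid_eq_appendR:
  "braid_eq n u v \<Longrightarrow> a \<in> braid_words n \<Longrightarrow> braid_eq n (u @ a) (v @ a)"
  by (intro braid_eq.append braid_eq.refl)

text \<open>The two cancelled factors may be different words for the same braid. In
  \<open>good_unique\<close> they are cables of two words whose equality is still to be
  proved.\<close>

lemma braid_eq_cancelL:
  assumes uv: "braid_eq n (a @ u) (b @ v)" and ab: "braid_eq n a b"
  shows "braid_eq n u v"
proof -
  have w: "a \<in> braid_words n" "b \<in> braid_words n" "u \<in> braid_words n" "v \<in> braid_words n"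
    using braid_eq_words[OF uv] by auto
  have "braid_eq n ([] @ u) ((inv_word a @ a) @ u)"
    using w by (intro braid_eq_appendR braid_eq.sym[OF inv_word_left])
  also have "\<dots> = inv_word a @ (a @ u)" by simp
  also have "braid_eq n \<dots> (inv_word a @ (b @ v))" using w uv by (intro braid_eq_appendL) auto
  also have "braid_eq n \<dots> (inv_word b @ (b @ v))"
    using w by (intro braid_eq_appendR inv_word_cong ab) auto
  also have "\<dots> = (inv_word b @ b) @ v" by simp
  also have "braid_eq n \<dots> ([] @ v)" using w by (intro braid_eq_appendR inv_word_left)
  finally show ?thesis by simp
qed

lemma braid_eq_cancelR:
  assumes "braid_eq n (u @ a) (v @ b)" and "braid_eq n a b"
  shows "braid_eq n u v"
proof -
  have "braid_eq n (inv_word u) (inv_word v)"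
    using inv_word_cong[OF assms(1)] inv_word_cong[OF assms(2)]
    unfolding inv_word_simps by (rule braid_eq_cancelL)
  from inv_word_cong[OF this] show ?thesis by simp
qed

text \<open>The automorphism of the braid group that sends every generator to its inverse. Unlike
  \<open>inv_word\<close> it keeps the order of the letters, and it exchanges the braids with upper
  signs and those with lower signs.\<close>

definition mirror :: "braid_word \<Rightarrow> braid_word" where
  "mirror = map (\<lambda>(s, i). (\<not> s, i))"

lemma mirror_simps [simp]:
  "mirror [] = []" "mirror (l # w) = (\<not> fst l, snd l) # mirror w"
  "mirror (u @ v) = mirror u @ mirror v" "mirror (mirror w) = w"
  by (auto simp: mirror_def case_prod_beta intro!: map_idI)

lemma mirror_words [simp]: "mirror w \<in> braid_words n \<longleftrightarrow> w \<in> braid_words n"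
  by (induction w) auto

lemma mirror_cong: "braid_eq n u v \<Longrightarrow> braid_eq n (mirror u) (mirror v)"
proof (induction rule: braid_eq.induct)
  case (refl w) then show ?case by (simp add: braid_eq.refl)
next
  case (sym u v) then show ?case by (blast intro: braid_eq.sym)
next
  case (trans u v w) then show ?case by (blast intro: braid_eq.trans)
next
  case (append u u' v v') then show ?case by (simp add: braid_eq.append)
next
  case (cancel i s) then show ?case using braid_eq.cancel[of i n "\<not> s"] by simp
next
  case (far i j) then show ?case using letters_commute[of i n j False] by simp
next
  \<comment> \<open>Both sides of the braid relation are palindromes, so mirroring them is the same
    as inverting them.\<close>
  case (braid i) then show ?case using inv_word_cong[OF braid_eq.braid[of i n]] by simp
qed

lemma mirror_block: "mirror (block s f p q) = block (\<not> s) f p q"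
  by (simp add: mirror_def block_def map_concat comp_def)

lemma mirror_cable_word: "cable_word c (mirror w) = mirror (cable_word c w)"
  by (induction w arbitrary: c) (simp_all add: Let_def mirror_block)

lemma mirror_shift_word: "shift_word k (mirror w) = mirror (shift_word k w)"
  by (induction w) (auto simp: shift_word_def mirror_def)

lemma mirror_word_perm: "word_perm (mirror w) = word_perm w"
  by (induction w) auto

lemma shift_word_0 [simp]: "shift_word 0 w = w"
  by (auto simp: shift_word_def intro!: map_idI)

lemma shift_word_simps [simp]:
  "shift_word k [] = []"
  "shift_word k (l # w) = (fst l, snd l + k) # shift_word k w"
  "shift_word k (u @ v) = shift_word k u @ shift_word k v"
  by (auto simp: shift_word_def case_prod_beta)

section \<open>Sliding letters through blocks and cables\<close>

lemma slide_invert: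
  assumes "braid_eq n ([(e, i)] @ w) (w @ [(e, j)])"
  shows "braid_eq n ([(\<not> e, i)] @ w) (w @ [(\<not> e, j)])"
proof -
  have i: "i \<in> {1..<n}" "j \<in> {1..<n}" "w \<in> braid_words n" using braid_eq_words[OF assms] by auto
  have "[(\<not> e, i)] @ w = ([(\<not> e, i)] @ w) @ []" by simp
  also have "braid_eq n \<dots> (([(\<not> e, i)] @ w) @ [(e, j), (\<not> e, j)])"
    using i by (intro braid_eq_appendL braid_eq.sym[OF braid_eq.cancel]) auto
  also have "\<dots> = [(\<not> e, i)] @ (w @ [(e, j)]) @ [(\<not> e, j)]" by simp
  also have "braid_eq n \<dots> ([(\<not> e, i)] @ ([(e, i)] @ w) @ [(\<not> e, j)])"
    using i by (intro braid_eq_context braid_eq.sym[OF assms]) auto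
  also have "\<dots> = [(\<not> e, i), (\<not> \<not> e, i)] @ (w @ [(\<not> e, j)])" by simp
  also have "braid_eq n \<dots> ([] @ (w @ [(\<not> e, j)]))"
    using i by (intro braid_eq_appendR braid_eq.cancel) auto
  finally show ?thesis by simp
qed

text \<open>A letter of the block's own sign can be handled in the positive and negative monoid; the
  opposite sign then follows by \<open>slide_invert\<close>.\<close>

lemma slide_signs:
  assumes "\<And>s. braid_eq n ([(s, i)] @ block s f p q) (block s f p q @ [(s, j)])"
  shows "braid_eq n ([(e, i)] @ block s f p q) (block s f p q @ [(e, j)])"
proof (cases "e = s")
  case False
  then have "e = (\<not> s)" by auto
  then show ?thesis using slide_invert[OF assms[of s]] by simp
qed (simp only: assms)

text \<open>Naturality of the braiding: a crossing inside the right-hand group of \<open>m\<close>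
  strands is pushed through the crossing with \<open>p\<close> strands, which moves the group
  \<open>p\<close> places to the left. Negative blocks are mirror images.\<close>

lemma block_slide_right:
  assumes "1 \<le> f" "f + p + m \<le> Suc n" "f \<le> k" "k + 2 \<le> f + m"
  shows "braid_eq n ([(e, k + p)] @ block s f p m) (block s f p m @ [(e, k)])"
proof (rule slide_signs)
  fix s
  have *: "braid_eq n ([(True, k + p)] @ block True f p m) (block True f p m @ [(True, k)])"
    using assms by (intro block_slide)
  show "braid_eq n ([(s, k + p)] @ block s f p m) (block s f p m @ [(s, k)])"
    using * mirror_cong[OF *] by (cases s) (auto simp: mirror_block)
qed

text \<open>The inverse of a block is a \<open>colblock\<close> of opposite sign with the two groups
  exchanged. Inverting \<open>block_slide_right\<close> therefore turns the right-hand group into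
  the left-hand one.\<close>

lemma block_slide_left:
  assumes "1 \<le> f" "f + m + q \<le> Suc n" "f \<le> k" "k + 2 \<le> f + m"
  shows "braid_eq n ([(e, k)] @ block s f m q) (block s f m q @ [(e, k + q)])"
proof -
  have c: "braid_eq n (colblock s f m q) (block s f m q)"
    using assms by (intro braid_eq.sym[OF block_colblock]) auto
  have k: "[(e, k)] \<in> braid_words n" "[(e, k + q)] \<in> braid_words n" using assms by auto
  have "braid_eq n (inv_word ([(\<not> e, k + q)] @ block (\<not> s) f q m)) (inv_word (block (\<not> s) f q m @ [(\<not> e, k)]))"
    using assms by (intro inv_word_cong block_slide_right) auto
  then have *: "braid_eq n (colblock s f m q @ [(e, k + q)]) ([(e, k)] @ colblock s f m q)"
    by (simp add: inv_word_block)
  have "braid_eq n ([(e, k)] @ block s f m q) ([(e, k)] @ colblock s f m q)"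
    using k by (intro braid_eq_appendL braid_eq.sym[OF c])
  also have "braid_eq n \<dots> (colblock s f m q @ [(e, k + q)])" by (rule braid_eq.sym[OF *])
  also have "braid_eq n \<dots> (block s f m q @ [(e, k + q)])" using k by (intro braid_eq_appendR c)
  finally show ?thesis .
qed

lemma block_slide_outside:
  assumes "1 \<le> f" "f + p + q \<le> Suc n" "k \<in> {1..<n}" "k + 2 \<le> f \<or> f + p + q \<le> k"
  shows "braid_eq n ([(e, k)] @ block s f p q) (block s f p q @ [(e, k)])"
proof (rule slide_signs)
  show "braid_eq n ([(s, k)] @ block s f p q) (block s f p q @ [(s, k)])" for s
    using assms by (intro words_commute[where s = s] block_words) (auto simp: set_block)
qed

text \<open>The copies \<open>t < c i\<close> of strand \<open>i\<close> are counted from 0, positions from 1.\<close>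

definition strand_pos :: "(nat \<Rightarrow> nat) \<Rightarrow> nat \<Rightarrow> nat \<Rightarrow> nat" where
  "strand_pos c i t = 1 + (\<Sum>k=1..<i. c k) + t"

lemma strand_pos_transpose:
  assumes "1 \<le> i" "1 \<le> j"
  shows "strand_pos (c \<circ> transpose j (Suc j)) (transpose j (Suc j) i) t =
    (if i = j then strand_pos c j t + c (Suc j)
     else if i = Suc j then strand_pos c j t else strand_pos c i t)"
proof -
  consider "i = j" | "i = Suc j" | "i < j" | "Suc j < i" by linarith
  then show ?thesis
  proof cases
    case 1 then show ?thesis
      using assms sum_transpose_below[of j j c] by (simp add: strand_pos_def)
  next
    case 2 then show ?thesis
      using assms sum_transpose_below[of j j c] by (simp add: strand_pos_def)
  next
    case 3 then show ?thesis
      using assms sum_transpose_below[of i j c] by (simp add: strand_pos_def)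
  next
    case 4 then show ?thesis
      using assms sum_transpose_above[of j i c] by (simp add: strand_pos_def)
  qed
qed

lemma strand_pos_Suc: "1 \<le> i \<Longrightarrow> strand_pos c (Suc i) t = strand_pos c i t + c i"
  by (simp add: strand_pos_def)

lemma strand_pos_mono: "i \<le> j \<Longrightarrow> strand_pos c i 0 \<le> strand_pos c j 0"
  by (auto simp: strand_pos_def intro!: sum_mono2)

lemma strand_pos_t: "strand_pos c i t = strand_pos c i 0 + t"
  by (simp add: strand_pos_def)

lemma strand_pos_bound:
  assumes "i \<le> Suc n"
  shows "strand_pos c i 0 \<le> Suc (\<Sum>k=1..n. c k)"
  using sum_bound[OF assms, of c] by (simp add: strand_pos_def)

lemma cable_word_Cons:
  "cable_word c (l # w) = block (fst l) (strand_pos c (snd l) 0) (c (snd l)) (c (Suc (snd l)))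
    @ cable_word (c \<circ> transpose (snd l) (Suc (snd l))) w"
  by (simp add: Let_def strand_pos_def)

text \<open>Copies \<open>t\<close> and \<open>t + 1\<close> of one strand run parallel through the
  whole cabled braid, so a crossing between them can be pulled along their ribbon from top to
  bottom, one block at a time.\<close>

lemma cable_slide:
  "w \<in> braid_words n \<Longrightarrow> i \<in> {1..n} \<Longrightarrow> t + 2 \<le> c i \<Longrightarrow>
    braid_eq (\<Sum>k=1..n. c k) ([(e, strand_pos c i t)] @ cable_word c w)
      (cable_word c w @ [(e, strand_pos (relabel c w) (word_perm w i) t)])"
proof (induction w arbitrary: c i)
  case Nil
  have "strand_pos c i 0 + c i \<le> Suc (\<Sum>k=1..n. c k)"
    using Nil strand_pos_bound[of "Suc i" n c] by (simp add: strand_pos_Suc)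
  then show ?case using Nil strand_pos_t[of c i t]
    by (auto intro!: braid_eq.refl simp: strand_pos_def)
next
  case (Cons l w)
  obtain s j where l: "l = (s, j)" by (cases l)
  let ?T = "transpose j (Suc j)" and ?N = "\<Sum>k=1..n. c k" and ?f = "strand_pos c j 0"
  let ?B = "block s ?f (c j) (c (Suc j))"
  have j: "j \<in> {1..<n}" and w: "w \<in> braid_words n" using Cons.prems l by auto
  have N: "(\<Sum>k=1..n. (c \<circ> ?T) k) = ?N" by (rule sum_transpose[OF j])
  have f: "1 \<le> ?f" "?f + c j + c (Suc j) \<le> Suc ?N"
    using j strand_pos_bound[of "Suc (Suc j)" n c] by (simp_all add: strand_pos_Suc) (simp add: strand_pos_def)
  have k: "strand_pos c i 0 + c i \<le> Suc ?N"
    using Cons.prems strand_pos_bound[of "Suc i" n c] by (simp add: strand_pos_Suc)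
  have Ti: "?T i \<in> {1..n}" using j Cons.prems by (auto simp: transpose_def)
  have IH: "braid_eq ?N ([(e, strand_pos (c \<circ> ?T) (?T i) t)] @ cable_word (c \<circ> ?T) w)
      (cable_word (c \<circ> ?T) w @ [(e, strand_pos (relabel (c \<circ> ?T) w) (word_perm w (?T i)) t)])"
    using Cons.IH[OF w Ti, of "c \<circ> ?T"] Cons.prems unfolding N by (simp add: comp_def)
  have B: "braid_eq ?N ([(e, strand_pos c i t)] @ ?B) (?B @ [(e, strand_pos (c \<circ> ?T) (?T i) t)])"
  proof -
    have p: "strand_pos (c \<circ> ?T) (?T i) t = (if i = j then strand_pos c j t + c (Suc j)
     else if i = Suc j then strand_pos c j t else strand_pos c i t)"
      using j Cons.prems by (intro strand_pos_transpose) auto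
    \<comment> \<open>The ribbon is the left one of the crossing, the right one, or lies outside on
      either side.\<close>
    consider "i = j" | "i = Suc j" | "i < j" | "Suc j < i" by linarith
    then show ?thesis
    proof cases
      case 1
      have q: "strand_pos (c \<circ> ?T) (?T i) t = strand_pos c i t + c (Suc j)" unfolding p using 1 by simp
      show ?thesis unfolding q using 1 Cons.prems f
        by (intro block_slide_left) (auto simp: strand_pos_t[of c j t])
    next
      case 2
      have q: "strand_pos (c \<circ> ?T) (?T i) t = strand_pos c j t" unfolding p using 2 by simp
      have r: "strand_pos c i t = strand_pos c j t + c j" using 2 j by (simp add: strand_pos_Suc)
      show ?thesis unfolding q r using 2 Cons.prems f
        by (intro block_slide_right) (auto simp: strand_pos_t[of c j t])
    next
      case 3
      have "strand_pos c i 0 + c i \<le> ?f"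
        using 3 strand_pos_mono[of "Suc i" j c] Cons.prems by (simp add: strand_pos_Suc)
      moreover have q: "strand_pos (c \<circ> ?T) (?T i) t = strand_pos c i t" unfolding p using 3 by simp
      ultimately show ?thesis unfolding q using Cons.prems f k
        by (intro block_slide_outside)
           (auto simp: strand_pos_t[of c i t] strand_pos_def)
    next
      case 4
      have "?f + c j + c (Suc j) \<le> strand_pos c i 0"
        using 4 strand_pos_mono[of "Suc (Suc j)" i c] j by (simp add: strand_pos_Suc)
      moreover have q: "strand_pos (c \<circ> ?T) (?T i) t = strand_pos c i t" unfolding p using 4 by simp
      ultimately show ?thesis unfolding q using Cons.prems f k
        by (intro block_slide_outside)
           (auto simp: strand_pos_t[of c i t])
    qed
  qed
  have cw: "cable_word (c \<circ> ?T) w \<in> braid_words ?N" using cable_word_words[OF w, of "c \<circ> ?T"] unfolding N .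
  have Bw: "?B \<in> braid_words ?N" using f by (intro block_words)
  have "braid_eq ?N ([(e, strand_pos c i t)] @ ?B @ cable_word (c \<circ> ?T) w)
      (?B @ cable_word (c \<circ> ?T) w @ [(e, strand_pos (relabel (c \<circ> ?T) w) (word_perm w (?T i)) t)])"
    using braid_eq_appendR[OF B cw] braid_eq_appendL[OF IH Bw] unfolding append_assoc
    by (rule braid_eq.trans)
  moreover have "cable_word c (l # w) = ?B @ cable_word (c \<circ> ?T) w"
    "relabel c (l # w) = relabel (c \<circ> ?T) w" "word_perm (l # w) i = word_perm w (?T i)"
    unfolding cable_word_Cons relabel.simps word_perm.simps l by simp_all
  ultimately show ?case by (simp only: append_assoc)
qed

section \<open>Cabling a cabled braid\<close>

lemma word_perm_row:
  "word_perm (row s f q) k = (if k = f then f + q else if f < k \<and> k \<le> f + q then k - 1 else k)"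
proof (induction q arbitrary: k)
  case 0 then show ?case by (simp add: row_def)
next
  case (Suc q)
  have "row s f (Suc q) = row s f q @ [(s, f + q)]" by (simp add: row_def)
  then show ?case using Suc by (auto simp: word_perm_append transpose_def)
qed

lemma word_perm_block:
  "word_perm (block s f p q) k =
    (if f \<le> k \<and> k < f + p then k + q else if f + p \<le> k \<and> k < f + p + q then k - p else k)"
proof (induction p arbitrary: k)
  case 0 then show ?case by simp
next
  case (Suc p)
  have "word_perm (block s f (Suc p) q) k = word_perm (block s f p q) (word_perm (row s (f + p) q) k)"
    by (simp add: block_Suc word_perm_append)
  then show ?case unfolding Suc word_perm_row by auto
qed

text \<open>Multiplicities travel with their strands: \<open>relabel c w\<close> is \<open>c\<close>
  composed with the inverse permutation, stated here without forming that inverse.\<close>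

lemma relabel_word_perm: "relabel c w (word_perm w k) = c k"
  by (induction w arbitrary: c k) simp_all

lemma strand_pos_block:
  assumes "1 \<le> i" "1 \<le> j" "t < c i"
  shows "word_perm (block s (strand_pos c j 0) (c j) (c (Suc j))) (strand_pos c i t)
    = strand_pos (c \<circ> transpose j (Suc j)) (transpose j (Suc j) i) t"
proof -
  have S: "strand_pos c (Suc j) t = strand_pos c j 0 + c j + t" for t
    using assms by (simp add: strand_pos_def)
  have S2: "strand_pos c (Suc (Suc j)) t = strand_pos c j 0 + c j + c (Suc j) + t" for t
    using assms by (simp add: strand_pos_def)
  consider "i = j" | "i = Suc j" | "i < j" | "Suc j < i" by linarith
  then show ?thesis
  proof cases
    case 1 then show ?thesis using assms unfolding strand_pos_transpose[OF assms(1,2)] word_perm_block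
      by (simp add: strand_pos_t[of c j t])
  next
    case 2 then show ?thesis using assms unfolding strand_pos_transpose[OF assms(1,2)] word_perm_block
      by (simp add: S strand_pos_t[of c j t])
  next
    case 3
    have "strand_pos c i t < strand_pos c j 0"
      using 3 strand_pos_mono[of "Suc i" j c] assms by (simp add: strand_pos_Suc strand_pos_t[of c i t])
    then show ?thesis using 3 assms unfolding strand_pos_transpose[OF assms(1,2)] word_perm_block
      by simp
  next
    case 4
    have "strand_pos c (Suc (Suc j)) 0 \<le> strand_pos c i t"
      using 4 strand_pos_mono[of "Suc (Suc j)" i c] by (simp add: strand_pos_t[of c i t])
    then show ?thesis using 4 assms unfolding strand_pos_transpose[OF assms(1,2)] word_perm_block
      by (simp add: S2)
  qed
qed

text \<open>Copies of one strand never cross each other, so they keep their numbers within the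
  ribbon.\<close>

lemma word_perm_cable_word:
  "w \<in> braid_words n \<Longrightarrow> 1 \<le> i \<Longrightarrow> t < c i \<Longrightarrow>
    word_perm (cable_word c w) (strand_pos c i t) = strand_pos (relabel c w) (word_perm w i) t"
proof (induction w arbitrary: c i)
  case (Cons l w)
  let ?T = "transpose (snd l) (Suc (snd l))"
  have "word_perm (cable_word c (l # w)) (strand_pos c i t)
      = word_perm (cable_word (c \<circ> ?T) w) (strand_pos (c \<circ> ?T) (?T i) t)"
    unfolding cable_word_Cons word_perm_append o_apply
    using Cons.prems by (subst strand_pos_block) (auto simp: comp_def)
  also have "\<dots> = strand_pos (relabel (c \<circ> ?T) w) (word_perm w (?T i)) t"
    using Cons.prems by (intro Cons.IH) (auto simp: transpose_def)
  finally show ?case by simp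
qed simp

lemma block_add: "block s f (p + r) q = block s (f + p) r q @ block s f p q"
  by (induction r) (simp_all add: block_Suc ac_simps)

lemma relabel_row:
  "relabel d (row s f q) k = (if k = f + q then d f else if f \<le> k \<and> k < f + q then d (Suc k) else d k)"
proof (induction q arbitrary: k)
  case 0 then show ?case by (simp add: row_def)
next
  case (Suc q)
  have "row s f (Suc q) = row s f q @ [(s, f + q)]" by (simp add: row_def)
  then show ?case using Suc by (auto simp: relabel_append transpose_def)
qed

text \<open>One ribbon crosses \<open>q\<close> others in turn, and \<open>block_split\<close> fuses
  these crossings into a single block.\<close>

lemma cable_word_row:
  assumes "1 \<le> f"
  shows "f + q \<le> n \<Longrightarrow> braid_eq (\<Sum>k=1..n. d k) (cable_word d (row s f q))
    (block s (1 + (\<Sum>k=1..<f. d k)) (d f) (\<Sum>k=Suc f..<Suc f + q. d k))"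
proof (induction q)
  case 0
  have "block s (1 + sum d {1..<f}) (d f) 0 = []" by (simp add: block_def)
  then show ?case using 0 by (simp add: row_def braid_eq.refl)
next
  case (Suc q)
  let ?N = "\<Sum>k=1..n. d k" and ?F = "1 + (\<Sum>k=1..<f. d k)" and ?Q = "\<Sum>k=Suc f..<Suc f + q. d k"
  have r: "row s f (Suc q) = row s f q @ [(s, f + q)]" by (simp add: row_def)
  \<comment> \<open>The ribbons already crossed now lie to the left of the moving one; this shifts
    the next block by \<open>?Q\<close>.\<close>
  have "(\<Sum>k=1..<f+q. relabel d (row s f q) k)
      = (\<Sum>k=1..<f. relabel d (row s f q) k) + (\<Sum>k=f..<f+q. relabel d (row s f q) k)"
    using assms by (simp add: sum.atLeastLessThan_concat)
  also have "(\<Sum>k=1..<f. relabel d (row s f q) k) = (\<Sum>k=1..<f. d k)"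
    by (intro sum.cong) (auto simp: relabel_row)
  also have "(\<Sum>k=f..<f+q. relabel d (row s f q) k) = (\<Sum>k=f..<f+q. d (Suc k))"
    by (intro sum.cong) (auto simp: relabel_row)
  also have "\<dots> = ?Q" by (subst sum.shift_bounds_Suc_ivl[symmetric]) simp
  finally have pos: "1 + (\<Sum>k=1..<f+q. relabel d (row s f q) k) = ?F + ?Q" by simp
  have "(\<Sum>k=1..<Suc (f + q). d k) = (\<Sum>k=1..<Suc f. d k) + ?Q"
    unfolding add_Suc by (rule sum.atLeastLessThan_concat[symmetric]) simp_all
  then have bound: "?F + d f + ?Q + d (Suc (f + q)) \<le> Suc ?N"
    using sum_bound[of "Suc (Suc (f + q))" n d] Suc.prems assms by simp
  have "cable_word d (row s f (Suc q)) = cable_word d (row s f q) @ block s (?F + ?Q) (d f) (d (Suc (f + q)))"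
    unfolding r cable_word_append using pos by (simp add: relabel_row Let_def)
  also have "braid_eq ?N \<dots> (block s ?F (d f) ?Q @ block s (?F + ?Q) (d f) (d (Suc (f + q))))"
    using Suc.prems bound by (intro braid_eq_appendR Suc.IH block_words) auto
  also have "braid_eq ?N \<dots> (block s ?F (d f) (?Q + d (Suc (f + q))))"
    using bound by (intro block_split) auto
  also have "?Q + d (Suc (f + q)) = (\<Sum>k=Suc f..<Suc f + Suc q. d k)" by simp
  finally show ?case .
qed

text \<open>A crossing of two groups of ribbons is the crossing of the two groups of all their
  strands. The induction splits off one row at a time.\<close>

lemma cable_word_block:
  assumes "1 \<le> f"
  shows "f + p + q \<le> Suc n \<Longrightarrow> braid_eq (\<Sum>k=1..n. d k) (cable_word d (block s f p q))
    (block s (1 + (\<Sum>k=1..<f. d k)) (\<Sum>k=f..<f+p. d k) (\<Sum>k=f+p..<f+p+q. d k))"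
proof (induction p arbitrary: d)
  case 0 then show ?case by (simp add: braid_eq.refl)
next
  case (Suc p)
  let ?N = "\<Sum>k=1..n. d k" and ?F = "1 + (\<Sum>k=1..<f. d k)" and ?P = "\<Sum>k=f..<f+p. d k"
    and ?Q = "\<Sum>k=f+Suc p..<f+Suc p+q. d k" and ?r = "row s (f + p) q"
  let ?d = "relabel d ?r"
  have r: "?r \<in> braid_words n" using Suc.prems assms by (intro row_words) auto
  have s: "(\<Sum>k=1..<f. ?d k) = (\<Sum>k=1..<f. d k)" "(\<Sum>k=f..<f+p. ?d k) = ?P"
    by (auto intro!: sum.cong simp: relabel_row)
  have "(\<Sum>k=f+p..<f+p+q. ?d k) = (\<Sum>k=f+p..<f+p+q. d (Suc k))"
    by (intro sum.cong) (auto simp: relabel_row)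
  also have "\<dots> = ?Q" by (subst sum.shift_bounds_Suc_ivl[symmetric]) simp
  finally have Q: "(\<Sum>k=f+p..<f+p+q. ?d k) = ?Q" .
  have FP: "1 + (\<Sum>k=1..<f+p. d k) = ?F + ?P"
    using assms by (simp add: sum.atLeastLessThan_concat)
  have IH: "braid_eq ?N (cable_word ?d (block s f p q)) (block s ?F ?P ?Q)"
    using Suc.IH[of ?d] Suc.prems unfolding sum_relabel[OF r] s Q by simp
  have row: "braid_eq ?N (cable_word d ?r) (block s (?F + ?P) (d (f + p)) ?Q)"
    using cable_word_row[of "f + p" q n d s] Suc.prems assms unfolding FP by (simp add: add.assoc)
  have P: "(\<Sum>k=f..<f + Suc p. d k) = ?P + d (f + p)" by simp
  show ?case unfolding block_Suc cable_word_append P block_add by (rule braid_eq.append[OF row IH])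
qed

text \<open>The multiplicities that result from taking \<open>d k\<close> copies of each strand \<open>k\<close> of the
  braid in which strand \<open>i\<close> is already replaced by \<open>c i\<close> copies.\<close>

definition merge :: "(nat \<Rightarrow> nat) \<Rightarrow> (nat \<Rightarrow> nat) \<Rightarrow> nat \<Rightarrow> nat" where
  "merge c d i = (\<Sum>t<c i. d (strand_pos c i t))"

lemma merge_interval: "merge c d i = (\<Sum>k=strand_pos c i 0..<strand_pos c i 0 + c i. d k)"
proof -
  have "(\<Sum>k=strand_pos c i 0..<strand_pos c i 0 + c i. d k) = (\<Sum>t=0..<c i. d (t + strand_pos c i 0))"
    using sum.shift_bounds_nat_ivl[of d 0 "strand_pos c i 0" "c i"] by (simp add: add.commute)
  then show ?thesis by (simp add: merge_def lessThan_atLeast0 strand_pos_def ac_simps)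
qed

lemma sum_merge:
  assumes "1 \<le> j" shows "(\<Sum>k=1..<j. merge c d k) = (\<Sum>k=1..<strand_pos c j 0. d k)"
  using assms
proof (induction j rule: dec_induct)
  case base then show ?case by (simp add: strand_pos_def)
next
  case (step j)
  then have "(\<Sum>k=1..<Suc j. merge c d k) = (\<Sum>k=1..<strand_pos c j 0. d k)
      + (\<Sum>k=strand_pos c j 0..<strand_pos c j 0 + c j. d k)"
    by (simp add: merge_interval)
  also have "\<dots> = (\<Sum>k=1..<strand_pos c j 0 + c j. d k)"
    by (intro sum.atLeastLessThan_concat) (auto simp: strand_pos_def)
  finally show ?case using step by (simp add: strand_pos_Suc)
qed

lemma cable_word_agree:
  "w \<in> braid_words n \<Longrightarrow> (\<And>k. k \<in> {1..n} \<Longrightarrow> c k = c' k) \<Longrightarrow> cable_word c w = cable_word c' w"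
proof (induction w arbitrary: c c')
  case (Cons l w)
  obtain s j where l: "l = (s, j)" by (cases l)
  have "cable_word (c \<circ> transpose j (Suc j)) w = cable_word (c' \<circ> transpose j (Suc j)) w"
    using Cons.prems l by (intro Cons.IH) (auto simp: transpose_def)
  moreover have "c j = c' j" "c (Suc j) = c' (Suc j)" "(\<Sum>k=1..<j. c k) = (\<Sum>k=1..<j. c' k)"
    using Cons.prems l by (auto intro!: sum.cong)
  ultimately show ?case using l by (simp add: Let_def)
qed simp

text \<open>A letter of \<open>w\<close> becomes a block under the first cabling and remains a block
  under the second, by \<open>cable_word_block\<close>. The point to check is that the
  multiplicities below this block still merge correctly.\<close>

theorem cable_word_cable_word:
  "w \<in> braid_words n \<Longrightarrow> N = (\<Sum>k=1..(\<Sum>k=1..n. c k). d k) \<Longrightarrow>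
    braid_eq N (cable_word d (cable_word c w)) (cable_word (merge c d) w)"
proof (induction w arbitrary: c d)
  case Nil then show ?case by (simp add: braid_eq.refl)
next
  case (Cons l w)
  obtain s j where l: "l = (s, j)" by (cases l)
  let ?T = "transpose j (Suc j)" and ?f = "strand_pos c j 0"
  let ?B = "block s ?f (c j) (c (Suc j))" and ?M = "\<Sum>k=1..n. c k"
  let ?d = "relabel d ?B"
  have j: "j \<in> {1..<n}" and w: "w \<in> braid_words n" using Cons.prems l by auto
  have M: "(\<Sum>k=1..n. (c \<circ> ?T) k) = ?M" by (rule sum_transpose[OF j])
  have f: "1 \<le> ?f" "?f + c j + c (Suc j) \<le> Suc ?M"
    using j strand_pos_bound[of "Suc (Suc j)" n c] by (simp_all add: strand_pos_Suc) (simp add: strand_pos_def)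
  have Bw: "?B \<in> braid_words ?M" using f by (intro block_words)
  \<comment> \<open>Ribbons pass through the block with the order of their copies intact, so summing
    over a ribbon gives the same result above and below it.\<close>
  have m: "merge (c \<circ> ?T) ?d k = (merge c d \<circ> ?T) k" if "1 \<le> k" for k
  proof -
    have "?d (strand_pos (c \<circ> ?T) k t) = d (strand_pos c (?T k) t)" if "t < c (?T k)" for t
    proof -
      have "1 \<le> ?T k" using \<open>1 \<le> k\<close> j by (auto simp: transpose_def)
      then show ?thesis
        using strand_pos_block[of "?T k" j t c s] that j relabel_word_perm[of d ?B "strand_pos c (?T k) t"]
        by simp
    qed
    then show ?thesis by (simp add: merge_def)
  qed
  have 1: "(\<Sum>k=?f..<?f + c j. d k) = merge c d j"
    "(\<Sum>k=?f + c j..<?f + c j + c (Suc j). d k) = merge c d (Suc j)"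
    using j by (simp_all only: merge_interval strand_pos_Suc atLeastLessThan_iff)
  have 2: "1 + (\<Sum>k=1..<?f. d k) = strand_pos (merge c d) j 0"
    using j sum_merge[of j c d] unfolding strand_pos_def[of "merge c d"] by simp
  have "braid_eq (\<Sum>k=1..?M. d k) (cable_word d ?B)
      (block s (1 + (\<Sum>k=1..<?f. d k)) (\<Sum>k=?f..<?f + c j. d k) (\<Sum>k=?f + c j..<?f + c j + c (Suc j). d k))"
    by (rule cable_word_block[OF f])
  then have B: "braid_eq N (cable_word d ?B)
      (block s (strand_pos (merge c d) j 0) (merge c d j) (merge c d (Suc j)))"
    using Cons.prems unfolding 1 2 by simp
  have N: "N = (\<Sum>k=1..(\<Sum>k=1..n. (c \<circ> ?T) k). ?d k)"
    unfolding M sum_relabel[OF Bw] using Cons.prems by simp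
  have "braid_eq N (cable_word ?d (cable_word (c \<circ> ?T) w)) (cable_word (merge (c \<circ> ?T) ?d) w)"
    by (rule Cons.IH[OF w N])
  also have "cable_word (merge (c \<circ> ?T) ?d) w = cable_word (merge c d \<circ> ?T) w"
    by (rule cable_word_agree[OF w m]) simp
  finally have "braid_eq N (cable_word d ?B @ cable_word ?d (cable_word (c \<circ> ?T) w))
     (block s (strand_pos (merge c d) j 0) (merge c d j) (merge c d (Suc j)) @ cable_word (merge c d \<circ> ?T) w)"
    by (rule braid_eq.append[OF B])
  then show ?case unfolding l cable_word_Cons fst_conv snd_conv cable_word_append .
qed

text \<open>The first \<open>k\<close> strands cross nothing, so the number of their copies only
  sets the new shift.\<close>

lemma cable_shift_word:
  "w \<in> braid_words n \<Longrightarrow>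
    cable_word d (shift_word k w) = shift_word (\<Sum>i=1..k. d i) (cable_word (\<lambda>i. d (i + k)) w)"
proof (induction w arbitrary: d)
  case (Cons l w)
  obtain s j where l: "l = (s, j)" by (cases l)
  have j: "1 \<le> j" using Cons.prems l by simp
  have "{1..<j + k} = {1..k} \<union> {1 + k..<j + k}" using j by auto
  then have "(\<Sum>i=1..<j + k. d i) = (\<Sum>i=1..k. d i) + (\<Sum>i=1 + k..<j + k. d i)"
    by (simp only:) (rule sum.union_disjoint, auto)
  also have "(\<Sum>i=1 + k..<j + k. d i) = (\<Sum>i=1..<j. d (i + k))"
    by (rule sum.shift_bounds_nat_ivl)
  finally have a: "(\<Sum>i=1..<j + k. d i) = (\<Sum>i=1..k. d i) + (\<Sum>i=1..<j. d (i + k))" .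
  have b: "(\<Sum>i=1..k. (d \<circ> transpose (j + k) (Suc (j + k))) i) = (\<Sum>i=1..k. d i)"
    using j by (intro sum.cong) (auto simp: transpose_def)
  have c: "(\<lambda>i. (d \<circ> transpose (j + k) (Suc (j + k))) (i + k)) = (\<lambda>i. d (i + k)) \<circ> transpose j (Suc j)"
    by (auto simp: transpose_def)
  have sb: "shift_word m (block s f p q) = block s (f + m) p q" for m f p q
    by (simp add: shift_word_def block_def map_concat comp_def ac_simps)
  show ?case
    using Cons.IH[of "d \<circ> transpose (j + k) (Suc (j + k))"] Cons.prems
    unfolding b c
    by (simp only: l shift_word_simps cable_word.simps Let_def fst_conv snd_conv sb a braid_words_simps)
      (simp add: ac_simps)
qed simp

lemma relabel_shift_word:
  "w \<in> braid_words n \<Longrightarrow>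
    relabel d (shift_word k w) i = (if i \<le> k then d i else relabel (\<lambda>j. d (j + k)) w (i - k))"
proof (induction w arbitrary: d)
  case (Cons l w)
  obtain s j where l: "l = (s, j)" by (cases l)
  have j: "1 \<le> j" using Cons.prems l by simp
  have c: "(\<lambda>i. (d \<circ> transpose (j + k) (Suc (j + k))) (i + k)) = (\<lambda>i. d (i + k)) \<circ> transpose j (Suc j)"
    by (auto simp: transpose_def)
  have e: "(d \<circ> transpose (j + k) (Suc (j + k))) i = d i" if "i \<le> k"
    using that j by (simp add: transpose_def)
  show ?case
    using Cons.IH[of "d \<circ> transpose (j + k) (Suc (j + k))"] Cons.prems e
    unfolding c by (simp add: l comp_def)
qed simp

section \<open>The defining equations, cabled\<close>

text \<open>Only the values at \<open>1, \<dots>, length ms\<close> are meaningful.\<close>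

definition mults :: "nat list \<Rightarrow> nat \<Rightarrow> nat" where
  "mults ms k = ms ! (k - 1)"

abbreviation cab :: "nat \<Rightarrow> nat \<Rightarrow> nat \<Rightarrow> nat \<Rightarrow> braid_word \<Rightarrow> braid_word" where
  "cab a b c d \<equiv> cable_word (mults [a, b, c, d])"

text \<open>The conditions of \<open>interchanging_unital\<close> for a representing word, with
  deletion and doubling expressed by multiplicities 0 and 2; see
  \<open>interchanging_unital_class\<close>.\<close>

definition good_word :: "braid_word \<Rightarrow> bool" where
  "good_word w \<longleftrightarrow> w \<in> braid_words 4 \<and> word_perm w = transpose 2 3 \<and>
    braid_eq 6 (w @ cab 2 2 1 1 w) (shift_word 2 w @ cab 1 1 2 2 w) \<and>
    braid_eq 6 (cab 1 2 1 2 w @ shift_word 2 w) (cab 2 1 2 1 w @ w) \<and>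
    braid_eq 2 (cab 0 0 1 1 w) [] \<and> braid_eq 2 (cab 1 1 0 0 w) [] \<and>
    braid_eq 2 (cab 0 1 0 1 w) [] \<and> braid_eq 2 (cab 1 0 1 0 w) []"

lemma atLeastAtMost_4: "k \<in> {1..4} \<longleftrightarrow> k = 1 \<or> k = 2 \<or> k = 3 \<or> k = (4::nat)" by auto

lemma sum_4: "(\<Sum>k=1..4::nat. f k) = f 1 + f 2 + f 3 + (f 4 :: nat)"
  by (simp add: eval_nat_numeral)

lemma sum_6: "(\<Sum>k=1..6::nat. f k) = f 1 + f 2 + f 3 + f 4 + f 5 + (f 6 :: nat)"
  by (simp add: eval_nat_numeral)

lemma mults_simps [simp]:
  "mults [a, b, c, d] 1 = a" "mults [a, b, c, d] (Suc 0) = a" "mults [a, b, c, d] 2 = b"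
  "mults [a, b, c, d] 3 = c" "mults [a, b, c, d] 4 = d"
  by (simp_all add: mults_def)

lemma strand_pos_simps:
  "strand_pos c 1 t = 1 + t" "strand_pos c 2 t = 1 + c 1 + t"
  "strand_pos c 3 t = 1 + c 1 + c 2 + t" "strand_pos c 4 t = 1 + c 1 + c 2 + c 3 + t"
  by (simp_all add: strand_pos_def eval_nat_numeral)

lemma cable_word_eq_cab:
  "w \<in> braid_words 4 \<Longrightarrow> cable_word c w = cab (c 1) (c 2) (c 3) (c 4) w"
  by (rule cable_word_agree) (auto simp only: atLeastAtMost_4 mults_simps)

lemma cab_words:
  "w \<in> braid_words 4 \<Longrightarrow> N = a + b + c + d \<Longrightarrow> cab a b c d w \<in> braid_words N"
  using cable_word_words[of w 4 "mults [a, b, c, d]"] unfolding sum_4 by simp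

lemma cab_1: "w \<in> braid_words 4 \<Longrightarrow> cab 1 1 1 1 w = w"
proof -
  have "cable_word (\<lambda>_. 1) w = w" if "w \<in> braid_words n" for n w
    using that
  proof (induction w)
    case (Cons l w)
    have "(\<lambda>_. 1) \<circ> transpose (snd l) (Suc (snd l)) = (\<lambda>_. 1 :: nat)" by auto
    then show ?case using Cons by (simp add: Let_def block_def comp_def)
  qed simp
  then show "w \<in> braid_words 4 \<Longrightarrow> cab 1 1 1 1 w = w"
    using cable_word_eq_cab[of w "\<lambda>_. 1"] by simp
qed

lemma cab_double_strands:
  assumes "w \<in> braid_words 4"
  shows "double_strands 4 {1, 2} (braid_class 4 w) = braid_class 6 (cab 2 2 1 1 w)"
    "double_strands 4 {3, 4} (braid_class 4 w) = braid_class 6 (cab 1 1 2 2 w)"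
    "double_strands 4 {2, 4} (braid_class 4 w) = braid_class 6 (cab 1 2 1 2 w)"
    "double_strands 4 {1, 3} (braid_class 4 w) = braid_class 6 (cab 2 1 2 1 w)"
  unfolding double_strands_def braid_cable_class[OF assms] sum_4
  using cable_word_eq_cab[OF assms, of "\<lambda>k. if k \<in> {1, 2} then 2 else 1"]
    cable_word_eq_cab[OF assms, of "\<lambda>k. if k \<in> {3, 4} then 2 else 1"]
    cable_word_eq_cab[OF assms, of "\<lambda>k. if k \<in> {2, 4} then 2 else 1"]
    cable_word_eq_cab[OF assms, of "\<lambda>k. if k \<in> {1, 3} then 2 else 1"]
  by (simp_all add: eval_nat_numeral)

lemma cab_delete_strands:
  assumes "w \<in> braid_words 4"
  shows "delete_strands 4 {1, 2} (braid_class 4 w) = braid_class 2 (cab 0 0 1 1 w)"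
    "delete_strands 4 {3, 4} (braid_class 4 w) = braid_class 2 (cab 1 1 0 0 w)"
    "delete_strands 4 {2, 4} (braid_class 4 w) = braid_class 2 (cab 1 0 1 0 w)"
    "delete_strands 4 {1, 3} (braid_class 4 w) = braid_class 2 (cab 0 1 0 1 w)"
  unfolding delete_strands_def braid_cable_class[OF assms] sum_4
  using cable_word_eq_cab[OF assms, of "\<lambda>k. if k \<in> {1, 2} then 0 else 1"]
    cable_word_eq_cab[OF assms, of "\<lambda>k. if k \<in> {3, 4} then 0 else 1"]
    cable_word_eq_cab[OF assms, of "\<lambda>k. if k \<in> {2, 4} then 0 else 1"]
    cable_word_eq_cab[OF assms, of "\<lambda>k. if k \<in> {1, 3} then 0 else 1"]
  by (simp_all add: numeral_2_eq_2)

lemma braid_group_simps: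
  "carrier (braid_group n) = braid_class n ` braid_words n" "\<one>\<^bsub>braid_group n\<^esub> = braid_class n []"
  by (simp_all add: braid_group_def)

lemma interchanging_unital_class:
  assumes w: "w \<in> braid_words 4"
  shows "interchanging_unital (braid_class 4 w) \<longleftrightarrow> good_word w"
proof -
  have s: "braid_shift 6 0 (braid_class 4 w) = braid_class 6 w"
    "braid_shift 6 2 (braid_class 4 w) = braid_class 6 (shift_word 2 w)"
    using w by (simp_all add: braid_shift_class)
  have c: "w \<in> braid_words 6" "shift_word 2 w \<in> braid_words 6"
    using shift_word_words[OF w, of 0 6] shift_word_words[OF w, of 2 6] by simp_all
  have d: "cab 2 2 1 1 w \<in> braid_words 6" "cab 1 1 2 2 w \<in> braid_words 6"
    "cab 1 2 1 2 w \<in> braid_words 6" "cab 2 1 2 1 w \<in> braid_words 6"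
    "cab 0 0 1 1 w \<in> braid_words 2" "cab 1 1 0 0 w \<in> braid_words 2"
    "cab 0 1 0 1 w \<in> braid_words 2" "cab 1 0 1 0 w \<in> braid_words 2"
    using w by (simp_all add: cab_words)
  show ?thesis
    using w c d imageI[OF w, of "braid_class 4"]
    by (simp add: interchanging_unital_def good_word_def braid_L_def braid_R_def braid_L'_def
      braid_R'_def s cab_double_strands[unfolded One_nat_def] cab_delete_strands[unfolded One_nat_def]
      braid_mult_class braid_class_eq_iff braid_perm_class braid_group_simps conj_ac)
qed

lemma relabel_eq:
  assumes "word_perm w = transpose 2 3" shows "relabel c w = c \<circ> transpose 2 3"
proof
  fix k show "relabel c w k = (c \<circ> transpose 2 3) k"
    using relabel_word_perm[of c w "transpose 2 3 k"] assms by simp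
qed

lemma merge_mults:
  "c i = 0 \<Longrightarrow> merge c d i = 0"
  "c i = Suc 0 \<Longrightarrow> merge c d i = d (strand_pos c i 0)"
  "c i = 2 \<Longrightarrow> merge c d i = d (strand_pos c i 0) + d (strand_pos c i 1)"
  by (simp_all add: merge_def eval_nat_numeral)

lemma cab_cab:
  assumes w: "w \<in> braid_words 4" and M: "a1 + a2 + a3 + a4 = M" and N: "N = (\<Sum>k=1..M. d k)"
  shows "braid_eq N (cable_word d (cab a1 a2 a3 a4 w))
    (cab (merge (mults [a1, a2, a3, a4]) d 1) (merge (mults [a1, a2, a3, a4]) d 2)
      (merge (mults [a1, a2, a3, a4]) d 3) (merge (mults [a1, a2, a3, a4]) d 4) w)"
proof -
  have "N = (\<Sum>k=1..(\<Sum>k=1..4. mults [a1, a2, a3, a4] k). d k)" unfolding sum_4 using M N by simp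
  from cable_word_cable_word[OF w this] show ?thesis
    using cable_word_eq_cab[OF w, of "merge (mults [a1, a2, a3, a4]) d"] by simp
qed

lemma braid_eq_rewrite:
  assumes "braid_eq n (a @ b) (c @ d)" "braid_eq n a a'" "braid_eq n b b'" "braid_eq n c c'" "braid_eq n d d'"
  shows "braid_eq n (a' @ b') (c' @ d')"
  using braid_eq.trans[OF braid_eq.trans[OF braid_eq.sym[OF braid_eq.append[OF assms(2,3)]] assms(1)]
      braid_eq.append[OF assms(4,5)]] .

context
  fixes w assumes good: "good_word w"
begin

lemma good_words: "w \<in> braid_words 4" and good_perm: "word_perm w = transpose 2 3"
  using good by (auto simp: good_word_def)

lemma good_interchange: "braid_eq 6 (w @ cab 2 2 1 1 w) (shift_word 2 w @ cab 1 1 2 2 w)"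
  and good_interchange': "braid_eq 6 (cab 1 2 1 2 w @ shift_word 2 w) (cab 2 1 2 1 w @ w)"
  using good by (auto simp: good_word_def)

text \<open>Finds the top position \<open>x\<close> whose strand reaches the bottom position
  \<open>y\<close> of a cable. This evaluates \<open>relabel\<close> although the word
  \<open>w\<close> is unknown; only its permutation enters.\<close>

lemma good_perm_cable:
  assumes "1 \<le> i" "t < c i" "strand_pos c i t = x"
    "strand_pos (c \<circ> transpose 2 3) (transpose 2 3 i) t = y"
  shows "relabel d (cable_word c w) y = d x"
  using relabel_word_perm[of d "cable_word c w" "strand_pos c i t"]
    word_perm_cable_word[of w 4 i t c] assms
  by (simp add: good_words good_perm relabel_eq)

text \<open>The equation \<open>L b = R b\<close> with strand \<open>k\<close> of the six replaced
  by \<open>dk\<close> copies, possibly none. Sums such as \<open>d1 + d3\<close> arise because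
  \<open>w\<close> exchanges positions 2 and 3, which makes strands 1 and 3 the two edges of one
  ribbon.\<close>

lemma good_L:
  assumes N: "N = d1 + d2 + d3 + d4 + d5 + d6"
  shows "braid_eq N (cab d1 d2 d3 d4 w @ cab (d1 + d3) (d2 + d4) d5 d6 w)
    (shift_word (d1 + d2) (cab d3 d4 d5 d6 w) @ cab d1 d2 (d3 + d5) (d4 + d6) w)"
proof -
  note w = good_words
  define d where "d = mults [d1, d2, d3, d4, d5, d6]"
  have d: "d 1 = d1" "d (Suc 0) = d1" "d 2 = d2" "d 3 = d3" "d 4 = d4" "d 5 = d5" "d 6 = d6"
    "d (Suc (Suc 0)) = d2" "d (Suc (Suc (Suc 0))) = d3" "d (Suc (Suc (Suc (Suc 0)))) = d4"
    "d (Suc (Suc (Suc (Suc (Suc 0))))) = d5" "d (Suc (Suc (Suc (Suc (Suc (Suc 0)))))) = d6"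
    by (simp_all add: d_def mults_def)
  have N6: "N = (\<Sum>k=1..6. d k)" unfolding sum_6 d by (rule N)
  have s: "shift_word 2 w \<in> braid_words 6" "w \<in> braid_words 6"
    using shift_word_words[OF w, of 2 6] shift_word_words[OF w, of 0 6] by simp_all
  have *: "braid_eq N (cable_word d w @ cable_word (relabel d w) (cab 2 2 1 1 w))
      (cable_word d (shift_word 2 w) @ cable_word (relabel d (shift_word 2 w)) (cab 1 1 2 2 w))"
    using cable_word_cong[OF good_interchange, of d] unfolding N6 cable_word_append .
  have 1: "cable_word d w = cab d1 d2 d3 d4 w"
    using cable_word_eq_cab[OF w, of d] unfolding d .
  have 2: "braid_eq N (cable_word (relabel d w) (cab 2 2 1 1 w)) (cab (d1 + d3) (d2 + d4) d5 d6 w)"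
  proof -
    have "N = (\<Sum>k=1..6. relabel d w k)" using sum_relabel[OF s(2), of d] N6 by simp
    from cab_cab[OF w _ this, of 2 2 1 1] show ?thesis
      by (simp add: merge_mults strand_pos_simps[unfolded One_nat_def] relabel_eq[OF good_perm] transpose_def d comp_def)
  qed
  have "(\<Sum>k=1..2::nat. d k) = d 1 + d 2" by (simp add: numeral_2_eq_2)
  then have sh: "(\<Sum>k=1..2::nat. d k) = d1 + d2" "d (1 + 2) = d3" "d (2 + 2) = d4" "d (3 + 2) = d5" "d (4 + 2) = d6"
    by (simp_all add: d)
  have 3: "cable_word d (shift_word 2 w) = shift_word (d1 + d2) (cab d3 d4 d5 d6 w)"
    using cable_shift_word[OF w, of d 2] cable_word_eq_cab[OF w, of "\<lambda>i. d (i + 2)"]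
    unfolding sh by simp
  have 4: "braid_eq N (cable_word (relabel d (shift_word 2 w)) (cab 1 1 2 2 w)) (cab d1 d2 (d3 + d5) (d4 + d6) w)"
  proof -
    define r where "r = relabel d (shift_word 2 w)"
    have r: "r k = (if k \<le> 2 then d k else d (transpose 2 3 (k - 2) + 2))" for k
      by (simp add: r_def relabel_shift_word[OF w] relabel_eq[OF good_perm])
    \<comment> \<open>The shifted braid exchanges positions 4 and 5, so \<open>d5\<close> comes
      before \<open>d4\<close>.\<close>
    have rv: "r (Suc 0) = d1" "r (Suc (Suc 0)) = d2" "r (Suc (Suc (Suc 0))) = d3"
      "r (Suc (Suc (Suc (Suc 0)))) = d5" "r (Suc (Suc (Suc (Suc (Suc 0))))) = d4"
      "r (Suc (Suc (Suc (Suc (Suc (Suc 0)))))) = d6"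
      by (simp_all add: r transpose_def d)
    have "N = (\<Sum>k=1..6. r k)" using sum_relabel[OF s(1), of d] N6 by (simp add: r_def)
    from cab_cab[OF w _ this, of 1 1 2 2] show ?thesis unfolding r_def[symmetric]
      by (simp add: merge_mults strand_pos_simps[unfolded One_nat_def] rv)
  qed
  show ?thesis
  proof (rule braid_eq_rewrite[OF * _ 2 _ 4])
    show "braid_eq N (cable_word d w) (cab d1 d2 d3 d4 w)"
      unfolding 1[symmetric] using cable_word_words[OF s(2), of d] N6 by (simp add: braid_eq.refl)
    show "braid_eq N (cable_word d (shift_word 2 w)) (shift_word (d1 + d2) (cab d3 d4 d5 d6 w))"
      unfolding 3[symmetric] using cable_word_words[OF s(1), of d] N6 by (simp add: braid_eq.refl)
  qed
qed

text \<open>The same for \<open>L' b = R' b\<close>. Here the cabled factor comes first, so the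
  multiplicities of the second factor depend on the permutation of a cable.\<close>

lemma good_L':
  assumes N: "N = d1 + d2 + d3 + d4 + d5 + d6"
  shows "braid_eq N (cab d1 (d2 + d3) d4 (d5 + d6) w @ shift_word (d1 + d4) (cab d2 d3 d5 d6 w))
    (cab (d1 + d2) d3 (d4 + d5) d6 w @ cab d1 d2 d4 d5 w)"
proof -
  note w = good_words
  define d where "d = mults [d1, d2, d3, d4, d5, d6]"
  define e where "e = relabel d (cab 1 2 1 2 w)"
  define f where "f = relabel d (cab 2 1 2 1 w)"
  have d: "d 1 = d1" "d (Suc 0) = d1" "d 2 = d2" "d 3 = d3" "d 4 = d4" "d 5 = d5" "d 6 = d6"
    "d (Suc (Suc 0)) = d2" "d (Suc (Suc (Suc 0))) = d3" "d (Suc (Suc (Suc (Suc 0)))) = d4"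
    "d (Suc (Suc (Suc (Suc (Suc 0))))) = d5" "d (Suc (Suc (Suc (Suc (Suc (Suc 0)))))) = d6"
    by (simp_all add: d_def mults_def)
  have N6: "N = (\<Sum>k=1..6. d k)" unfolding sum_6 d by (rule N)
  have s: "shift_word 2 w \<in> braid_words 6" "w \<in> braid_words 6"
    using shift_word_words[OF w, of 2 6] shift_word_words[OF w, of 0 6] by simp_all
  have c: "cab 1 2 1 2 w \<in> braid_words 6" "cab 2 1 2 1 w \<in> braid_words 6"
    using w by (simp_all add: cab_words)
  have *: "braid_eq N (cable_word d (cab 1 2 1 2 w) @ cable_word e (shift_word 2 w))
      (cable_word d (cab 2 1 2 1 w) @ cable_word f w)"
    using cable_word_cong[OF good_interchange', of d] unfolding N6 cable_word_append e_def f_def .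
  note pos = strand_pos_simps strand_pos_simps[unfolded One_nat_def]
  \<comment> \<open>\<open>e\<close> and \<open>f\<close> are the multiplicities below the first
    factor on either side. Each value is found by naming the strand and the copy that arrive at the
    position.\<close>
  have e1: "e 1 = d1"
    unfolding e_def by (subst good_perm_cable[of 1 0 _ 1]) (simp_all add: pos transpose_def d)
  have e2: "e 2 = d4"
    unfolding e_def by (subst good_perm_cable[of 3 0 _ 4]) (simp_all add: pos transpose_def d)
  have e3: "e 3 = d2"
    unfolding e_def by (subst good_perm_cable[of 2 0 _ 2]) (simp_all add: pos transpose_def d)
  have e4: "e 4 = d3"
    unfolding e_def by (subst good_perm_cable[of 2 1 _ 3]) (simp_all add: pos transpose_def d)
  have e5: "e 5 = d5"
    unfolding e_def by (subst good_perm_cable[of 4 0 _ 5]) (simp_all add: pos transpose_def d)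
  have e6: "e 6 = d6"
    unfolding e_def by (subst good_perm_cable[of 4 1 _ 6]) (simp_all add: pos transpose_def d)
  note e = e1 e1[unfolded One_nat_def] e2 e3 e4 e5 e6
  have f1: "f 1 = d1"
    unfolding f_def by (subst good_perm_cable[of 1 0 _ 1]) (simp_all add: pos transpose_def d)
  have f2: "f 2 = d2"
    unfolding f_def by (subst good_perm_cable[of 1 1 _ 2]) (simp_all add: pos transpose_def d)
  have f3: "f 3 = d4"
    unfolding f_def by (subst good_perm_cable[of 3 0 _ 4]) (simp_all add: pos transpose_def d)
  have f4: "f 4 = d5"
    unfolding f_def by (subst good_perm_cable[of 3 1 _ 5]) (simp_all add: pos transpose_def d)
  have f5: "f 5 = d3"
    unfolding f_def by (subst good_perm_cable[of 2 0 _ 3]) (simp_all add: pos transpose_def d)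
  have f6: "f 6 = d6"
    unfolding f_def by (subst good_perm_cable[of 4 0 _ 6]) (simp_all add: pos transpose_def d)
  note f = f1 f1[unfolded One_nat_def] f2 f3 f4 f5 f6
  have Ne: "(\<Sum>k=1..6. e k) = N" "(\<Sum>k=1..6. f k) = N" using N unfolding sum_6 e f by simp_all
  show ?thesis
  proof (rule braid_eq_rewrite[OF *])
    show "braid_eq N (cable_word d (cab 1 2 1 2 w)) (cab d1 (d2 + d3) d4 (d5 + d6) w)"
      using cab_cab[OF w _ N6, of 1 2 1 2] by (simp add: merge_mults pos d)
    show "braid_eq N (cable_word d (cab 2 1 2 1 w)) (cab (d1 + d2) d3 (d4 + d5) d6 w)"
      using cab_cab[OF w _ N6, of 2 1 2 1] by (simp add: merge_mults pos d)
    have "(\<Sum>k=1..2::nat. e k) = e 1 + e 2" by (simp add: numeral_2_eq_2)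
    then have sh: "(\<Sum>k=1..2::nat. e k) = d1 + d4" "e (1 + 2) = d2" "e (2 + 2) = d3" "e (3 + 2) = d5" "e (4 + 2) = d6"
      by (simp_all add: e e[unfolded numeral_3_eq_3])
    have "cable_word e (shift_word 2 w) = shift_word (d1 + d4) (cab d2 d3 d5 d6 w)"
      using cable_shift_word[OF w, of e 2] cable_word_eq_cab[OF w, of "\<lambda>i. e (i + 2)"]
      unfolding sh by simp
    then show "braid_eq N (cable_word e (shift_word 2 w)) (shift_word (d1 + d4) (cab d2 d3 d5 d6 w))"
      using cable_word_words[OF s(1), of e] Ne by (simp add: braid_eq.refl)
    have "cable_word f w = cab d1 d2 d4 d5 w" using cable_word_eq_cab[OF w, of f] unfolding f .
    then show "braid_eq N (cable_word f w) (cab d1 d2 d4 d5 w)"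
      using cable_word_words[OF s(2), of f] Ne by (simp add: braid_eq.refl)
  qed
qed

end

section \<open>Two-strand braids and a representation of the three-strand braid group\<close>

definition expo :: "braid_word \<Rightarrow> int" where
  "expo w = (\<Sum>l\<leftarrow>w. if fst l then 1 else - 1)"

lemma expo_simps [simp]:
  "expo [] = 0" "expo (l # w) = (if fst l then 1 else - 1) + expo w" "expo (u @ v) = expo u + expo v"
  by (simp_all add: expo_def)

lemma expo_cong: "braid_eq n u v \<Longrightarrow> expo u = expo v"
  by (induction rule: braid_eq.induct) auto

text \<open>At most one of the two powers is nonempty, since \<open>nat\<close> sends negative
  integers to 0.\<close>

lemma braid_word_2: "w \<in> braid_words 2 \<Longrightarrow> braid_eq 2 w (replicate (nat (expo w)) (True, 1) @ replicate (nat (- expo w)) (False, 1))"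
proof (induction w)
  case Nil then show ?case by (simp add: braid_eq.refl)
next
  case (Cons l w)
  define t where "t e = replicate (nat e) (True, 1 :: nat) @ replicate (nat (- e)) (False, 1)" for e
  obtain s where l: "l = (s, 1)" and w: "w \<in> braid_words 2" using Cons.prems by (cases l) auto
  have t2: "t e \<in> braid_words 2" for e by (auto simp: t_def braid_words_iff)
  have "braid_eq 2 ([l] @ w) ([l] @ t (expo w))"
    using Cons.IH w l unfolding t_def[symmetric] by (intro braid_eq_appendL) auto
  also have "braid_eq 2 ([l] @ t (expo w)) (t (expo (l # w)))"
  proof -
    consider "s" "0 \<le> expo w" | "s" "expo w < 0" | "\<not> s" "expo w \<le> 0" | "\<not> s" "0 < expo w" by linarith
    then show ?thesis
    proof cases
      case 1
      then have "[l] @ t (expo w) = t (expo (l # w))" using l by (simp add: t_def nat_add_distrib)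
      then show ?thesis using t2[of "expo (l # w)"] by (simp add: braid_eq.refl)
    next
      case 2
      then have "nat (- expo w) = Suc (nat (- expo (l # w)))" using l by simp
      then have "[l] @ t (expo w) = [(s, 1), (\<not> s, 1)] @ t (expo (l # w))" using 2 l by (simp add: t_def)
      then show ?thesis using braid_eq_appendR[OF braid_eq.cancel t2, of 1] by simp
    next
      case 3
      then have "nat (- expo (l # w)) = Suc (nat (- expo w))" using l by simp
      then have "[l] @ t (expo w) = t (expo (l # w))" using 3 l by (simp add: t_def)
      then show ?thesis using t2[of "expo (l # w)"] by (simp add: braid_eq.refl)
    next
      case 4
      then have "nat (expo w) = Suc (nat (expo (l # w)))" using l by simp
      then have "[l] @ t (expo w) = [(s, 1), (\<not> s, 1)] @ t (expo (l # w))" using 4 l by (simp add: t_def)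
      then show ?thesis using braid_eq_appendR[OF braid_eq.cancel t2, of 1] by simp
    qed
  qed
  finally show ?case by (simp add: t_def)
qed

text \<open>The two-strand braid group is infinite cyclic, so the exponent sum is a complete
  invariant.\<close>

lemma braid_eq_2_iff:
  assumes "u \<in> braid_words 2" "v \<in> braid_words 2" shows "braid_eq 2 u v \<longleftrightarrow> expo u = expo v"
proof
  assume "expo u = expo v"
  then show "braid_eq 2 u v"
    using braid_eq.trans[OF braid_word_2[OF assms(1)]] braid_eq.sym[OF braid_word_2[OF assms(2)]] by simp
qed (rule expo_cong)

lemma relabel_2:
  "w \<in> braid_words 2 \<Longrightarrow> relabel d w = (if even (expo w) then d else d \<circ> transpose 1 2)"
proof (induction w arbitrary: d)
  case (Cons l w)
  then have "snd l = 1" "w \<in> braid_words 2" by auto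
  moreover have "d \<circ> transpose 1 2 \<circ> transpose 1 2 = d" by auto
  ultimately show ?case using Cons.IH by (simp add: numeral_2_eq_2 comp_def)
qed simp

text \<open>The representation of the three-strand braid group by \<open>SL\<^sub>2(\<int>)\<close>, acting from the right.\<close>

fun gen_act :: "bool \<times> nat \<Rightarrow> int \<times> int \<Rightarrow> int \<times> int" where
  "gen_act (s, i) (x, y) = (let e = if s then 1 else - 1 in if i = 1 then (x + e * y, y) else (x, y - e * x))"

primrec act :: "braid_word \<Rightarrow> int \<times> int \<Rightarrow> int \<times> int" where
  "act [] = id"
| "act (l # w) = act w \<circ> gen_act l"

lemma act_append: "act (u @ v) = act v \<circ> act u"
  by (induction u) (auto simp: comp_assoc)

lemma act_cong: "braid_eq 3 u v \<Longrightarrow> act u = act v"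
proof (induction rule: braid_eq.induct)
  case (cancel i s) then show ?case by (cases s) (auto simp: Let_def)
next
  case (far i j) then show ?case by auto
next
  case (braid i) then have "i = 1" by auto
  then show ?case by (auto simp: Let_def)
qed (simp_all add: act_append)

lemma act_2: "w \<in> braid_words 2 \<Longrightarrow> act w (x, y) = (x + expo w * y, y)"
proof (induction w arbitrary: x)
  case (Cons l w)
  then obtain s where "l = (s, 1)" by (cases l) auto
  then show ?case using Cons by (cases s) (auto simp: Let_def algebra_simps)
qed simp

lemma act_shift_2: "w \<in> braid_words 2 \<Longrightarrow> act (shift_word 1 w) (x, y) = (x, y - expo w * x)"
proof (induction w arbitrary: y)
  case (Cons l w)
  then obtain s where "l = (s, 1)" by (cases l) auto
  then show ?case using Cons by (cases s) (auto simp: Let_def algebra_simps)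
qed simp

text \<open>With exponent \<open>e\<close> this cable is the braid \<open>\<sigma>\<^sub>2\<close>
  to the power \<open>-e\<close> followed by the \<open>e\<close>-th power of the half twist, and
  the square of the half twist acts as -1. The sign is left open because only its absolute value
  matters later.\<close>

lemma act_ribbon:
  assumes "w \<in> braid_words 2"
  shows "\<exists>\<epsilon>\<in>{1, - 1}. \<forall>x y. act (cable_word (\<lambda>k. if k = 1 then 1 else 2) w) (x, y) =
    (if even (expo w) then (\<epsilon> * x, \<epsilon> * (y + expo w * x)) else (\<epsilon> * (y + expo w * x), - \<epsilon> * x))"
  using assms
proof (induction w rule: rev_induct)
  case Nil then show ?case by (intro bexI[of _ 1]) auto
next
  case (snoc l w)
  let ?c = "\<lambda>k. if k = 1 then 1 else (2::nat)"
  obtain s where l: "l = (s, 1)" and w: "w \<in> braid_words 2" using snoc.prems by (cases l) auto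
  obtain \<epsilon> where \<epsilon>: "\<epsilon> \<in> {1, - 1}" and IH: "\<And>x y. act (cable_word ?c w) (x, y) =
    (if even (expo w) then (\<epsilon> * x, \<epsilon> * (y + expo w * x)) else (\<epsilon> * (y + expo w * x), - \<epsilon> * x))"
    using snoc.IH[OF w] by blast
  have c: "cable_word (relabel ?c w) [l] = (if even (expo w) then [(s, 1), (s, 2)] else [(s, 2), (s, 1)])"
    by (simp add: relabel_2[OF w] l block_def numeral_2_eq_2 transpose_def)
  have *: "act (cable_word ?c (w @ [l])) (x, y)
      = act (cable_word (relabel ?c w) [l]) (act (cable_word ?c w) (x, y))" for x y
    unfolding cable_word_append act_append by simp
  \<comment> \<open>A positive letter changes the sign after an odd prefix, a negative one after an
    even prefix.\<close>
  let ?e = "if even (expo w) = s then \<epsilon> else - \<epsilon>"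
  show ?case
  proof (rule bexI[of _ ?e])
    show "\<forall>x y. act (cable_word ?c (w @ [l])) (x, y) =
      (if even (expo (w @ [l])) then (?e * x, ?e * (y + expo (w @ [l]) * x))
      else (?e * (y + expo (w @ [l]) * x), - ?e * x))"
      unfolding * unfolding IH c unfolding l by (auto simp: algebra_simps Let_def)
  qed (use \<epsilon> in auto)
qed

section \<open>Interchanging unital braids have at most two invariants\<close>

lemma braid_eq_connect: "braid_eq n a b \<Longrightarrow> braid_eq n a c \<Longrightarrow> braid_eq n b d \<Longrightarrow> braid_eq n c d"
  by (rule braid_eq.trans[OF braid_eq.trans[OF braid_eq.sym]])

lemma braid_eq_mono: "braid_eq n u v \<Longrightarrow> n \<le> m \<Longrightarrow> braid_eq m u v"
  using shift_word_cong[of n 0 m u v] by simp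

lemma braid_words_mono: "w \<in> braid_words n \<Longrightarrow> n \<le> m \<Longrightarrow> w \<in> braid_words m"
  using shift_word_words[of w n 0 m] by simp

lemma sum_2: "(\<Sum>k=1..2::nat. f k) = f 1 + (f 2 :: nat)"
  and sum_3: "(\<Sum>k=1..3::nat. f k) = f 1 + f 2 + (f 3 :: nat)"
  by (simp_all add: eval_nat_numeral)

text \<open>Two strands remain, 1 and 4 or 2 and 3; doubling the second of them gives
  \<open>[1002]\<close> or \<open>[0120]\<close>.\<close>

lemma cab_1002:
  assumes "w \<in> braid_words 4"
  shows "braid_eq 3 (cable_word (\<lambda>k. if k = 1 then 1 else 2) (cab 1 0 0 1 w)) (cab 1 0 0 2 w)"
    "braid_eq 3 (cable_word (\<lambda>k. if k = 1 then 1 else 2) (cab 0 1 1 0 w)) (cab 0 1 2 0 w)"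
  using cab_cab[OF assms, of 1 0 0 1 2 3 "\<lambda>k. if k = 1 then 1 else 2"]
    cab_cab[OF assms, of 0 1 1 0 2 3 "\<lambda>k. if k = 1 then 1 else 2"]
  by (simp_all add: merge_mults strand_pos_simps[unfolded One_nat_def] sum_2[unfolded One_nat_def])

lemma cab_1012:
  assumes "w \<in> braid_words 4"
  shows "braid_eq 4 (cable_word (\<lambda>k. if k = 3 then 2 else 1) (cab 1 0 1 1 w)) (cab 1 0 1 2 w)"
  using cab_cab[OF assms, of 1 0 1 1 3 4 "\<lambda>k. if k = 3 then 2 else 1"]
  by (simp add: merge_mults strand_pos_simps[unfolded One_nat_def] sum_3[unfolded One_nat_def])

context
  fixes w assumes good: "good_word w"
begin

lemma good_parity: "even (expo (cab 1 0 0 1 w))" "odd (expo (cab 0 1 1 0 w))"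
proof -
  have v: "cab 1 0 0 1 w \<in> braid_words 2" "cab 0 1 1 0 w \<in> braid_words 2"
    using good_words[OF good] by (auto intro!: cab_words)
  \<comment> \<open>With \<open>id\<close> as multiplicities, \<open>relabel\<close> tells for each
    bottom position where its strand started.\<close>
  have "relabel id (cab 1 0 0 1 w) 1 = id 1"
    by (subst good_perm_cable[OF good, of 1 0 _ 1])
      (simp_all add: strand_pos_simps strand_pos_simps[unfolded One_nat_def] transpose_def)
  then show "even (expo (cab 1 0 0 1 w))"
    unfolding relabel_2[OF v(1)] by (auto split: if_splits)
  have "relabel id (cab 0 1 1 0 w) 2 = id 1"
    by (subst good_perm_cable[OF good, of 2 0 _ 1])
      (simp_all add: strand_pos_simps strand_pos_simps[unfolded One_nat_def] transpose_def)
  then show "odd (expo (cab 0 1 1 0 w))"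
    unfolding relabel_2[OF v(2)] by (auto split: if_splits)
qed

text \<open>Strands 1, 5 and 6 of \<open>L' b = R' b\<close> are kept. The factor
  \<open>[0011]\<close> on the left is trivial by unitality.\<close>

lemma good_1002: "braid_eq 3 (cab 1 0 0 2 w) (cab 1 0 1 1 w @ cab 1 0 0 1 w)"
proof -
  have "braid_eq 2 (cab 0 0 1 1 w) []" using good by (simp add: good_word_def)
  then have "braid_eq 3 (shift_word 1 (cab 0 0 1 1 w)) []"
    using shift_word_cong[of 2 1 3 "cab 0 0 1 1 w" "[]"] by simp
  then have "braid_eq 3 (cab 1 0 0 2 w @ shift_word 1 (cab 0 0 1 1 w)) (cab 1 0 0 2 w @ [])"
    using good_words[OF good] by (intro braid_eq_appendL cab_words) auto
  from braid_eq.trans[OF braid_eq.sym[OF this]] good_L'[OF good, of 3 1 0 0 0 1 1]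
  show ?thesis by (simp add: numeral_2_eq_2)
qed

text \<open>Strands 2, 3 and 5 of \<open>L b = R b\<close> are kept, and unitality removes
  \<open>[1010]\<close>.\<close>

lemma good_0120: "braid_eq 3 (cab 0 1 1 0 w @ cab 1 1 1 0 w) (cab 0 1 2 0 w)"
proof -
  have "braid_eq 2 (cab 1 0 1 0 w) []" using good by (simp add: good_word_def)
  then have "braid_eq 3 (shift_word 1 (cab 1 0 1 0 w)) []"
    using shift_word_cong[of 2 1 3 "cab 1 0 1 0 w" "[]"] by simp
  then have "braid_eq 3 (shift_word 1 (cab 1 0 1 0 w) @ cab 0 1 2 0 w) ([] @ cab 0 1 2 0 w)"
    using good_words[OF good] by (intro braid_eq_appendR cab_words) auto
  from braid_eq.trans[OF _ this] good_L[OF good, of 3 0 1 1 0 1 0]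
  show ?thesis by (simp add: numeral_2_eq_2)
qed

text \<open>Strands 1, 4 and 5 of \<open>L b = R b\<close> are kept. This is the relation that
  restricts the exponents.\<close>

lemma good_1110: "braid_eq 3 (cab 1 0 0 1 w @ cab 1 1 1 0 w) (shift_word 1 (cab 0 1 1 0 w) @ cab 1 0 1 1 w)"
  using good_L[OF good, of 3 1 0 0 1 1 0] by simp

text \<open>Strands 2, 4 and 6 of \<open>L' b = R' b\<close> are kept; this expresses
  \<open>[0111]\<close> by the other cables.\<close>

lemma good_0111: "braid_eq 3 (cab 0 1 1 1 w @ shift_word 1 (cab 1 0 0 1 w)) (cab 1 0 1 1 w @ cab 0 1 1 0 w)"
  using good_L'[OF good, of 3 0 1 0 1 0 1] by simp

text \<open>Deleting only strands 2 and 3 of \<open>L b = R b\<close> leaves \<open>b\<close> itself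
  as a factor.\<close>

lemma good_1111: "braid_eq 4 (cab 1 0 0 1 w @ w) (shift_word 1 (cab 0 1 1 1 w) @ cab 1 0 1 2 w)"
  using good_L[OF good, of 4 1 0 0 1 1 1] cab_1[OF good_words[OF good]] by (simp add: numeral_2_eq_2)

lemma good_exponents: "\<bar>expo (cab 1 0 0 1 w) - expo (cab 0 1 1 0 w)\<bar> = 1"
proof -
  define p where "p = expo (cab 1 0 0 1 w)"
  define q where "q = expo (cab 0 1 1 0 w)"
  have v: "cab 1 0 0 1 w \<in> braid_words 2" "cab 0 1 1 0 w \<in> braid_words 2"
    using good_words[OF good] by (auto intro!: cab_words)
  note par = good_parity[folded p_def q_def]
  define F G where "F = act (cab 1 1 1 0 w)" and "G = act (cab 1 0 1 1 w)"
  have "\<exists>\<delta>\<in>{1, - 1}. \<forall>x y. act (cable_word (\<lambda>k. if k = 1 then 1 else 2) (cab 1 0 0 1 w)) (x, y) = (\<delta> * x, \<delta> * (y + p * x))"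
    using act_ribbon[OF v(1), folded p_def] by (simp only: par if_True if_False)
  then obtain \<delta> where \<delta>: "\<delta> \<in> {1, - 1}"
    "\<And>x y. act (cable_word (\<lambda>k. if k = 1 then 1 else 2) (cab 1 0 0 1 w)) (x, y) = (\<delta> * x, \<delta> * (y + p * x))" by blast
  have "\<exists>\<epsilon>\<in>{1, - 1}. \<forall>x y. act (cable_word (\<lambda>k. if k = 1 then 1 else 2) (cab 0 1 1 0 w)) (x, y) = (\<epsilon> * (y + q * x), - \<epsilon> * x)"
    using act_ribbon[OF v(2), folded q_def] by (simp only: par if_True if_False)
  then obtain \<epsilon> where \<epsilon>: "\<epsilon> \<in> {1, - 1}"
    "\<And>x y. act (cable_word (\<lambda>k. if k = 1 then 1 else 2) (cab 0 1 1 0 w)) (x, y) = (\<epsilon> * (y + q * x), - \<epsilon> * x)" by blast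
  have A: "act (cab 1 0 0 1 w) (x, y) = (x + p * y, y)" "act (cab 0 1 1 0 w) (x, y) = (x + q * y, y)"
    "act (shift_word 1 (cab 0 1 1 0 w)) (x, y) = (x, y - q * x)" for x y
    unfolding p_def q_def by (rule act_2[OF v(1)] act_2[OF v(2)] act_shift_2[OF v(2)])+
  have 1: "(\<delta> * x, \<delta> * (y + p * x)) = act (cab 1 0 0 1 w) (G (x, y))" for x y
    using act_cong[OF cab_1002(1)[OF good_words[OF good]]] act_cong[OF good_1002] \<delta>(2)[of x y]
    by (simp add: act_append G_def)
  have 2: "(\<epsilon> * (y + q * x), - \<epsilon> * x) = F (x + q * y, y)" for x y
    using act_cong[OF cab_1002(2)[OF good_words[OF good]]] fun_cong[OF act_cong[OF good_0120], of "(x, y)"] \<epsilon>(2)[of x y] A(2)[of x y]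
    by (simp add: act_append F_def)
  have 3: "F (x + p * y, y) = G (x, y - q * x)" for x y
    using fun_cong[OF act_cong[OF good_1110], of "(x, y)"] A(1,3)[of x y]
    by (simp add: act_append F_def G_def)
  \<comment> \<open>At \<open>(1, 0)\<close> the second coordinate of \<open>F\<close> is a bare
    sign, while the relation between \<open>F\<close> and \<open>G\<close> gives it as a sign times
    \<open>p - q\<close>.\<close>
  have "snd (F (1, 0)) = - \<epsilon>" using 2[of 0 1] 2[of 1 0] by (metis add_0_right mult_zero_right mult.right_neutral snd_conv)
  moreover have "snd (G (1, - q)) = \<delta> * (p - q)"
    using arg_cong[OF 1[of 1 "- q"], of snd] A(1)[of "fst (G (1, - q))" "snd (G (1, - q))"] by simp
  moreover have "F (1, 0) = G (1, - q)" using 3[of 1 0] by simp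
  ultimately have "- \<epsilon> = \<delta> * (p - q)" by simp
  then show ?thesis using \<epsilon>(1) \<delta>(1) unfolding p_def q_def by auto
qed

end

text \<open>Equal exponents give equal \<open>[1001]\<close> and \<open>[0110]\<close>. Then
  \<open>[1002]\<close>, \<open>[1011]\<close>, \<open>[0111]\<close>, \<open>[1012]\<close> and the
  braid itself agree in turn, by cabling or by cancelling a factor already known to agree.\<close>

lemma good_unique:
  assumes u: "good_word u" and v: "good_word v"
    and p: "expo (cab 1 0 0 1 u) = expo (cab 1 0 0 1 v)" and q: "expo (cab 0 1 1 0 u) = expo (cab 0 1 1 0 v)"
  shows "braid_eq 4 u v"
proof -
  have w: "cab 1 0 0 1 u \<in> braid_words 2" "cab 0 1 1 0 u \<in> braid_words 2"
    "cab 1 0 0 1 v \<in> braid_words 2" "cab 0 1 1 0 v \<in> braid_words 2"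
    using good_words[OF u] good_words[OF v] by (auto intro!: cab_words)
  have 1: "braid_eq 2 (cab 1 0 0 1 u) (cab 1 0 0 1 v)" "braid_eq 2 (cab 0 1 1 0 u) (cab 0 1 1 0 v)"
    using p q w by (simp_all add: braid_eq_2_iff)
  note s = shift_word_cong[OF _ 1(1), of 1 3]
  have "braid_eq 3 (cab 1 0 0 2 u) (cab 1 0 0 2 v)"
  proof (rule braid_eq_connect[OF _ cab_1002(1)[OF good_words[OF u]] cab_1002(1)[OF good_words[OF v]]])
    show "braid_eq 3 (cable_word (\<lambda>k. if k = 1 then 1 else 2) (cab 1 0 0 1 u))
        (cable_word (\<lambda>k. if k = 1 then 1 else 2) (cab 1 0 0 1 v))"
      using cable_word_cong[OF 1(1), of "\<lambda>k. if k = 1 then 1 else 2"]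
      by (simp add: sum_2[unfolded One_nat_def] numeral_3_eq_3)
  qed
  then have "braid_eq 3 (cab 1 0 1 1 u @ cab 1 0 0 1 u) (cab 1 0 1 1 v @ cab 1 0 0 1 v)"
    by (rule braid_eq_connect[OF _ good_1002[OF u] good_1002[OF v]])
  then have 2: "braid_eq 3 (cab 1 0 1 1 u) (cab 1 0 1 1 v)"
    by (rule braid_eq_cancelR) (rule braid_eq_mono[OF 1(1)], simp)
  have "braid_eq 3 (cab 1 0 1 1 u @ cab 0 1 1 0 u) (cab 1 0 1 1 v @ cab 0 1 1 0 v)"
    by (rule braid_eq.append[OF 2 braid_eq_mono[OF 1(2)]]) simp
  then have "braid_eq 3 (cab 0 1 1 1 u @ shift_word 1 (cab 1 0 0 1 u)) (cab 0 1 1 1 v @ shift_word 1 (cab 1 0 0 1 v))"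
    by (rule braid_eq_connect[OF _ good_0111[OF u, THEN braid_eq.sym] good_0111[OF v, THEN braid_eq.sym]])
  then have 3: "braid_eq 3 (cab 0 1 1 1 u) (cab 0 1 1 1 v)"
    by (rule braid_eq_cancelR) (rule s, simp)
  have 4: "braid_eq 4 (cab 1 0 1 2 u) (cab 1 0 1 2 v)"
  proof (rule braid_eq_connect[OF _ cab_1012[OF good_words[OF u]] cab_1012[OF good_words[OF v]]])
    show "braid_eq 4 (cable_word (\<lambda>k. if k = 3 then 2 else 1) (cab 1 0 1 1 u))
        (cable_word (\<lambda>k. if k = 3 then 2 else 1) (cab 1 0 1 1 v))"
      using cable_word_cong[OF 2, of "\<lambda>k. if k = 3 then 2 else 1"]
      by (simp add: sum_3 eval_nat_numeral)
  qed
  have "braid_eq 4 (shift_word 1 (cab 0 1 1 1 u) @ cab 1 0 1 2 u) (shift_word 1 (cab 0 1 1 1 v) @ cab 1 0 1 2 v)"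
    by (rule braid_eq.append[OF shift_word_cong[OF _ 3] 4]) simp
  then have "braid_eq 4 (cab 1 0 0 1 u @ u) (cab 1 0 0 1 v @ v)"
    by (rule braid_eq_connect[OF _ good_1111[OF u, THEN braid_eq.sym] good_1111[OF v, THEN braid_eq.sym]])
  then show ?thesis by (rule braid_eq_cancelL) (rule braid_eq_mono[OF 1(1)], simp)
qed

section \<open>The standard braids\<close>

lemma block_q0 [simp]: "block s f p 0 = []"
  by (simp add: block_def)

lemma block_11 [simp]: "block s f (Suc 0) (Suc 0) = [(s, f)]"
  by (simp add: block_def)

lemma expo_block: "expo (block s f p q) = (if s then 1 else - 1) * int (p * q)"
proof (induction p)
  case (Suc p)
  have "expo (row s f q) = (if s then 1 else - 1) * int q" for f
    by (induction q) (simp_all add: row_def)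
  then show ?case using Suc by (simp add: block_Suc algebra_simps)
qed simp

lemma expo_mirror: "expo (mirror w) = - expo w"
  by (induction w) auto

text \<open>The passage from the \<open>n\<close>-th to the \<open>(n+1)\<close>-st standard braid with upper signs.\<close>

definition twist_step :: "braid_word \<Rightarrow> braid_word" where
  "twist_step w = block True 1 2 2 @ w @ [(False, 1), (False, 3)]"

text \<open>The commuting middle letters stand in the opposite order to \<open>std_braid\<close>;
  \<open>std_braid_class\<close> reconciles the two.\<close>

lemma twist_block: "block s 1 2 2 = [(s, 2), (s, 3), (s, 1), (s, 2)]"
  by (simp add: block_def eval_nat_numeral)

text \<open>The first factor moves ribbons \<open>c d\<close> in front of \<open>a b\<close>, and
  \<open>w\<close> then exchanges the middle two; hence the orders \<open>c d a b\<close> and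
  \<open>c a d b\<close> seen by the later factors.\<close>

lemma cab_step:
  assumes w: "w \<in> braid_words 4" and perm: "word_perm w = transpose 2 3" and N: "N = a + b + c + d"
  shows "braid_eq N (cab a b c d (twist_step w))
    (block True 1 (a + b) (c + d) @ cab c d a b w @ block False 1 c a @ block False (1 + a + c) d b)"
proof -
  let ?X = "block True 1 2 2" and ?Y = "[(False, 1), (False, 3)] :: braid_word" and ?m = "mults [a, b, c, d]"
  have X: "?X \<in> braid_words 4" and Y: "?Y \<in> braid_words 4" by (auto simp: twist_block[unfolded One_nat_def])
  have N4: "N = (\<Sum>k=1..4. ?m k)" using N by (simp add: sum_4[unfolded One_nat_def])
  have 1: "braid_eq N (cable_word ?m ?X) (block True 1 (a + b) (c + d))"
    using cable_word_block[of 1 2 2 4 ?m True] unfolding N4 by (simp add: eval_nat_numeral mults_def)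
  have r: "relabel ?m ?X k = mults [c, d, a, b] k" if "k \<in> {1..4}" for k
    using that unfolding atLeastAtMost_4 twist_block by (auto simp: transpose_def)
  have 2: "cable_word (relabel ?m ?X) w = cab c d a b w"
    by (rule cable_word_agree[OF w r])
  let ?e = "relabel (relabel ?m ?X) w"
  have e: "?e k = mults [c, a, d, b] k" if "k \<in> {1..4}" for k
    using that r[of "transpose 2 3 k"] unfolding relabel_eq[OF perm] atLeastAtMost_4
    by (auto simp: transpose_def)
  have "cable_word ?e ?Y = cab c a d b ?Y" by (rule cable_word_agree[OF Y e])
  also have "\<dots> = block False 1 c a @ block False (1 + a + c) d b"
    by (simp add: transpose_def eval_nat_numeral mults_def)
  finally have 3: "cable_word ?e ?Y = block False 1 c a @ block False (1 + a + c) d b" .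
  have "cab a b c d (twist_step w) = cable_word ?m ?X @ cable_word (relabel ?m ?X) w @ cable_word ?e ?Y"
    unfolding twist_step_def cable_word_append ..
  note this[unfolded 2 3]
  moreover have "cab c d a b w @ block False 1 c a @ block False (1 + a + c) d b \<in> braid_words N"
    using w N by (auto intro!: cab_words block_words)
  ultimately show ?thesis using braid_eq_appendR[OF 1] by simp
qed

section \<open>Moving words past crossings of ribbons\<close>

lemma slide_word:
  assumes "\<And>l. l \<in> set w \<Longrightarrow> braid_eq n ([(fst l, f (snd l))] @ B) (B @ [(fst l, g (snd l))])"
    and "B \<in> braid_words n"
  shows "braid_eq n (map (\<lambda>(s, i). (s, f i)) w @ B) (B @ map (\<lambda>(s, i). (s, g i)) w)"
  using assms(1)
proof (induction w)
  case Nil then show ?case using assms(2) by (simp add: braid_eq.refl)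
next
  case (Cons l w)
  obtain s i where l: "l = (s, i)" by (cases l)
  let ?f = "map (\<lambda>(s, i). (s, f i)) w" and ?g = "map (\<lambda>(s, i). (s, g i)) w"
  have IH: "braid_eq n (?f @ B) (B @ ?g)" using Cons by auto
  have L: "braid_eq n ([(s, f i)] @ B) (B @ [(s, g i)])" using Cons.prems[of l] l by simp
  have "braid_eq n ([(s, f i)] @ (?f @ B)) ([(s, f i)] @ (B @ ?g))"
    using braid_eq_words[OF L] by (intro braid_eq_appendL[OF IH]) auto
  moreover have "braid_eq n (([(s, f i)] @ B) @ ?g) ((B @ [(s, g i)]) @ ?g)"
    using braid_eq_words[OF IH] by (intro braid_eq_appendR[OF L]) auto
  ultimately show ?case using l by simp (rule braid_eq.trans)
qed

lemma letters_commute_signs: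
  assumes "i \<in> {1..<n}" "j \<in> {1..<n}" "i + 2 \<le> j \<or> j + 2 \<le> i"
  shows "braid_eq n [(s, i), (t, j)] [(t, j), (s, i)]"
proof (cases "s = t")
  case False
  then have "s = (\<not> t)" by auto
  then show ?thesis using slide_invert[of n t i "[(t, j)]" i] letters_commute[OF assms, of t] by simp
qed (use letters_commute[OF assms] in simp)

lemma slide_K42:
  assumes v: "v \<in> braid_words 4"
  shows "braid_eq 6 (v @ block True 1 4 2) (block True 1 4 2 @ shift_word 2 v)"
proof -
  have "braid_eq 6 (map (\<lambda>(s, i). (s, i)) v @ block True 1 4 2) (block True 1 4 2 @ map (\<lambda>(s, i). (s, i + 2)) v)"
  proof (rule slide_word)
    fix l assume "l \<in> set v"
    then have "1 \<le> snd l" "snd l < 4" using v by (auto simp: braid_words_iff)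
    then show "braid_eq 6 ([(fst l, snd l)] @ block True 1 4 2) (block True 1 4 2 @ [(fst l, snd l + 2)])"
      by (intro block_slide_left) auto
  qed (auto intro!: block_words)
  then show ?thesis by (simp add: shift_word_def)
qed

lemma slide_K24:
  assumes v: "v \<in> braid_words 4"
  shows "braid_eq 6 (shift_word 2 v @ block True 1 2 4) (block True 1 2 4 @ v)"
proof -
  have "braid_eq 6 (map (\<lambda>(s, i). (s, i + 2)) v @ block True 1 2 4) (block True 1 2 4 @ map (\<lambda>(s, i). (s, i)) v)"
  proof (rule slide_word)
    fix l assume "l \<in> set v"
    then have "1 \<le> snd l" "snd l < 4" using v by (auto simp: braid_words_iff)
    then show "braid_eq 6 ([(fst l, snd l + 2)] @ block True 1 2 4) (block True 1 2 4 @ [(fst l, snd l)])"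
      by (intro block_slide_right) auto
  qed (auto intro!: block_words)
  then show ?thesis by (simp add: shift_word_def)
qed

lemma slide_1:
  assumes v: "v \<in> braid_words 4"
  shows "braid_eq 6 (shift_word 2 v @ [(e, 1)]) ([(e, 1)] @ shift_word 2 v)"
proof -
  have "braid_eq 6 (map (\<lambda>(s, i). (s, i + 2)) v @ [(e, 1)]) ([(e, 1)] @ map (\<lambda>(s, i). (s, i + 2)) v)"
  proof (rule slide_word)
    fix l assume "l \<in> set v"
    then have "1 \<le> snd l" "snd l < 4" using v by (auto simp: braid_words_iff)
    then show "braid_eq 6 ([(fst l, snd l + 2)] @ [(e, 1)]) ([(e, 1)] @ [(fst l, snd l + 2)])"
      using letters_commute_signs[of "snd l + 2" 6 1 "fst l" e] by simp
  qed (auto intro!: block_words)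
  then show ?thesis by (simp add: shift_word_def)
qed

lemma slide_5:
  assumes v: "v \<in> braid_words 4"
  shows "braid_eq 6 (v @ [(e, 5)]) ([(e, 5)] @ v)"
proof -
  have "braid_eq 6 (map (\<lambda>(s, i). (s, i)) v @ [(e, 5)]) ([(e, 5)] @ map (\<lambda>(s, i). (s, i)) v)"
  proof (rule slide_word)
    fix l assume "l \<in> set v"
    then have "1 \<le> snd l" "snd l < 4" using v by (auto simp: braid_words_iff)
    then show "braid_eq 6 ([(fst l, snd l)] @ [(e, 5)]) ([(e, 5)] @ [(fst l, snd l)])"
      using letters_commute_signs[of "snd l" 6 5 "fst l" e] by simp
  qed (auto intro!: block_words)
  then show ?thesis by (simp add: shift_word_def)
qed


text \<open>Both sides are products of crossings of two-strand ribbons, and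
  \<open>block_braid\<close> is the braid relation for three such ribbons.\<close>

lemma twist_exchange:
  "braid_eq 6 (block True 1 4 2 @ shift_word 2 (block True 1 2 2)) (block True 1 2 4 @ block True 1 2 2)"
proof -
  have sh: "shift_word 2 (block True 1 2 2) = block True 3 2 2"
    by (simp add: block_def eval_nat_numeral)
  have a: "block True 1 4 2 = block True 3 2 2 @ block True 1 2 2"
    by (simp add: block_def eval_nat_numeral)
  have b: "braid_eq 6 (block True 1 2 2 @ block True 3 2 2 @ block True 1 2 2)
      (block True 3 2 2 @ block True 1 2 2 @ block True 3 2 2)"
    using block_braid[of 1 2 2 2 6] by (simp add: numeral_3_eq_3)
  have c: "braid_eq 6 ((block True 1 2 2 @ block True 3 2 2) @ block True 1 2 2) (block True 1 2 4 @ block True 1 2 2)"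
    using block_split[of 1 2 2 2 6 True]
    by (intro braid_eq_appendR) (auto intro!: block_words simp: eval_nat_numeral)
  from braid_eq.trans[OF braid_eq.sym[OF b] c[unfolded append_assoc]]
  show ?thesis unfolding sh a append_assoc .
qed

text \<open>Up to commuting distant letters, this is the inverse braid relation on strands 1 to 3
  next to the one on strands 4 to 6.\<close>

lemma tail_exchange:
  "braid_eq 6 ([(False, 2), (False, 5)] @ [(False, 1), (False, 2), (False, 4), (False, 5)])
    ([(False, 1), (False, 4)] @ [(False, 2), (False, 1), (False, 5), (False, 4)])"
proof -
  have 1: "braid_eq 6 [(False, 5), (False, 1), (False, 2)] [(False, 1), (False, 2), (False, 5)]"
    and 2: "braid_eq 6 [(False, 4), (False, 2), (False, 1)] [(False, 2), (False, 1), (False, 4)]"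
    using letter_word_commute[of 5 6 "[(False, 1), (False, 2)]" False]
      letter_word_commute[of 4 6 "[(False, 2), (False, 1)]" False] by simp_all
  have 3: "braid_eq 6 [(False, 2), (False, 1), (False, 2)] [(False, 1), (False, 2), (False, 1)]"
    "braid_eq 6 [(False, 5), (False, 4), (False, 5)] [(False, 4), (False, 5), (False, 4)]"
    using mirror_cong[OF braid_eq.braid[of 1 6]] mirror_cong[OF braid_eq.braid[of 4 6]]
    by (auto intro: braid_eq.sym simp: numeral_2_eq_2 eval_nat_numeral)
  have t1: "braid_eq 6 ([(False, 2)] @ [(False, 5), (False, 1), (False, 2)] @ [(False, 4), (False, 5)])
      ([(False, 2)] @ [(False, 1), (False, 2), (False, 5)] @ [(False, 4), (False, 5)])"
    using 1 by (rule braid_eq_context) auto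
  have t2: "braid_eq 6 ([(False, 2), (False, 1), (False, 2)] @ [(False, 5), (False, 4), (False, 5)])
      ([(False, 1), (False, 2), (False, 1)] @ [(False, 4), (False, 5), (False, 4)])"
    by (rule braid_eq.append[OF 3])
  have t3: "braid_eq 6 ([(False, 1)] @ [(False, 4), (False, 2), (False, 1)] @ [(False, 5), (False, 4)])
      ([(False, 1)] @ [(False, 2), (False, 1), (False, 4)] @ [(False, 5), (False, 4)])"
    using 2 by (rule braid_eq_context) auto
  note a = append_Cons append_Nil
  from braid_eq.trans[OF braid_eq.trans[OF t1[unfolded a] t2[unfolded a]] braid_eq.sym[OF t3[unfolded a]]]
  show ?thesis unfolding a .
qed

section \<open>The twist step preserves the defining conditions\<close>

context
  fixes w assumes good: "good_word w"
begin

text \<open>Ribbons 1 and 4 end where they began up to the widths beside them, while ribbon 2 or 3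
  changes places with a narrower or wider one; hence 3 becomes 2 in the first case and 4 in the
  second.\<close>

lemma slide_cab:
  "braid_eq 6 ([(e, 3), (e, 5)] @ cab 1 1 2 2 w) (cab 1 1 2 2 w @ [(e, 2), (e, 5)])"
  "braid_eq 6 ([(e, 1), (e, 3)] @ cab 2 2 1 1 w) (cab 2 2 1 1 w @ [(e, 1), (e, 4)])"
proof -
  note w = good_words[OF good] and perm = good_perm[OF good]
  note simps = relabel_eq[OF perm] perm sum_4[unfolded One_nat_def] strand_pos_simps strand_pos_simps[unfolded One_nat_def] transpose_def
  have C: "cab 1 1 2 2 w \<in> braid_words 6" "cab 2 2 1 1 w \<in> braid_words 6" using w by (auto intro!: cab_words)
  have 1: "braid_eq 6 ([(e, 3)] @ cab 1 1 2 2 w) (cab 1 1 2 2 w @ [(e, 2)])"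
    "braid_eq 6 ([(e, 5)] @ cab 1 1 2 2 w) (cab 1 1 2 2 w @ [(e, 5)])"
    using cable_slide[OF w, of 3 0 "mults [1, 1, 2, 2]" e] cable_slide[OF w, of 4 0 "mults [1, 1, 2, 2]" e]
    by (simp_all add: simps) (simp_all add: eval_nat_numeral)
  have 2: "braid_eq 6 ([(e, 1)] @ cab 2 2 1 1 w) (cab 2 2 1 1 w @ [(e, 1)])"
    "braid_eq 6 ([(e, 3)] @ cab 2 2 1 1 w) (cab 2 2 1 1 w @ [(e, 4)])"
    using cable_slide[OF w, of 1 0 "mults [2, 2, 1, 1]" e] cable_slide[OF w, of 2 0 "mults [2, 2, 1, 1]" e]
    by (simp_all add: simps) (simp_all add: eval_nat_numeral)
  have a: "braid_eq 6 ([(e, 3)] @ [(e, 5)] @ cab 1 1 2 2 w) ([(e, 3)] @ cab 1 1 2 2 w @ [(e, 5)])"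
    by (rule braid_eq_appendL[OF 1(2)]) simp
  have b: "braid_eq 6 (([(e, 3)] @ cab 1 1 2 2 w) @ [(e, 5)]) ((cab 1 1 2 2 w @ [(e, 2)]) @ [(e, 5)])"
    by (rule braid_eq_appendR[OF 1(1)]) simp
  from braid_eq.trans[OF a b[unfolded append_assoc]]
  show "braid_eq 6 ([(e, 3), (e, 5)] @ cab 1 1 2 2 w) (cab 1 1 2 2 w @ [(e, 2), (e, 5)])"
    by simp
  have c: "braid_eq 6 ([(e, 1)] @ [(e, 3)] @ cab 2 2 1 1 w) ([(e, 1)] @ cab 2 2 1 1 w @ [(e, 4)])"
    by (rule braid_eq_appendL[OF 2(2)]) simp
  have d: "braid_eq 6 (([(e, 1)] @ cab 2 2 1 1 w) @ [(e, 4)]) ((cab 2 2 1 1 w @ [(e, 1)]) @ [(e, 4)])"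
    by (rule braid_eq_appendR[OF 2(1)]) simp
  from braid_eq.trans[OF c d[unfolded append_assoc]]
  show "braid_eq 6 ([(e, 1), (e, 3)] @ cab 2 2 1 1 w) (cab 2 2 1 1 w @ [(e, 1), (e, 4)])"
    by simp
qed

lemma step_words: "twist_step w \<in> braid_words 4"
  using good_words[OF good] by (auto simp: twist_step_def intro!: block_words)

lemma step_perm: "word_perm (twist_step w) = transpose 2 3"
proof
  fix k :: nat
  consider "k = 0" | "k = 1" | "k = 2" | "k = 3" | "k = 4" | "k > 4" by linarith
  then show "word_perm (twist_step w) k = transpose 2 3 k"
    unfolding twist_step_def word_perm_append good_perm[OF good]
    by cases (auto simp: word_perm_block[unfolded One_nat_def] transpose_def)
qed

text \<open>The uncabled factor is moved past the leading crossing \<open>?K\<close> or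
  \<open>?K'\<close> of the cabled one, and its last two letters through the cable of
  \<open>w\<close>. Both sides then consist of crossings, an interchange term in \<open>w\<close>,
  and a tail, which match separately.\<close>

lemma step_L:
  "braid_eq 6 (twist_step w @ cab 2 2 1 1 (twist_step w)) (shift_word 2 (twist_step w) @ cab 1 1 2 2 (twist_step w))"
proof -
  note w = good_words[OF good] and perm = good_perm[OF good]
  let ?X = "block True 1 2 2" and ?K = "block True 1 4 2" and ?K' = "block True 1 2 4"
  let ?C = "cab 1 1 2 2 w" and ?C' = "cab 2 2 1 1 w" and ?Y = "[(False, 1), (False, 3)] :: braid_word"
  let ?Z = "[(False, 1), (False, 2), (False, 4), (False, 5)] :: braid_word"
    and ?Z' = "[(False, 2), (False, 1), (False, 5), (False, 4)] :: braid_word"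
  have C: "?C \<in> braid_words 6" "?C' \<in> braid_words 6" using w by (auto intro!: cab_words)
  have K: "?K \<in> braid_words 6" "?K' \<in> braid_words 6" by (auto intro!: block_words)
  have X: "?X \<in> braid_words 4" "?X \<in> braid_words 6" "shift_word 2 ?X \<in> braid_words 6"
    by (auto intro!: block_words shift_word_words[of _ 4])
  have w6: "w \<in> braid_words 6" "shift_word 2 w \<in> braid_words 6"
    using w braid_words_mono[OF w, of 6] shift_word_words[OF w, of 2 6] by auto
  note s = step_words braid_words_mono[OF step_words, of 6] shift_word_words[OF step_words, of 2 6]
  have Z: "block False 1 1 2 @ block False (1 + 2 + 1) 1 2 = ?Z"
    "block False 1 2 1 @ block False (1 + 1 + 2) 2 1 = ?Z'"
    by (simp_all add: block_def eval_nat_numeral)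
  have n: "2 + 2 = (4::nat)" "1 + 1 = (2::nat)" by simp_all
  have c: "braid_eq 6 (cab 2 2 1 1 (twist_step w)) (?K @ ?C @ ?Z)"
    "braid_eq 6 (cab 1 1 2 2 (twist_step w)) (?K' @ ?C' @ ?Z')"
    using cab_step[OF w perm, of 6 2 2 1 1, unfolded Z, unfolded n]
      cab_step[OF w perm, of 6 1 1 2 2, unfolded Z, unfolded n] by simp_all
  have sh: "?K @ shift_word 2 (twist_step w) = ?K @ shift_word 2 ?X @ shift_word 2 w @ [(False, 3), (False, 5)]"
    "?K' @ twist_step w = ?K' @ ?X @ w @ ?Y"
    by (simp_all add: twist_step_def)
  have 1: "braid_eq 6 (twist_step w @ cab 2 2 1 1 (twist_step w)) (twist_step w @ ?K @ ?C @ ?Z)"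
    using s by (intro braid_eq_appendL c) auto
  have 2: "braid_eq 6 ((twist_step w @ ?K) @ ?C @ ?Z) ((?K @ shift_word 2 (twist_step w)) @ ?C @ ?Z)"
    using s C by (intro braid_eq_appendR slide_K42) auto
  have 3: "braid_eq 6 ((?K @ shift_word 2 ?X @ shift_word 2 w) @ ([(False, 3), (False, 5)] @ ?C) @ ?Z)
      ((?K @ shift_word 2 ?X @ shift_word 2 w) @ (?C @ [(False, 2), (False, 5)]) @ ?Z)"
    using K X w6 by (intro braid_eq_context slide_cab) auto
  \<comment> \<open>The three parts are compared by \<open>twist_exchange\<close>, the assumption on
    \<open>w\<close>, and \<open>tail_exchange\<close>.\<close>
  have 4: "braid_eq 6 ((?K @ shift_word 2 ?X) @ (shift_word 2 w @ ?C) @ ([(False, 2), (False, 5)] @ ?Z))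
      ((?K' @ ?X) @ (w @ ?C') @ ([(False, 1), (False, 4)] @ ?Z'))"
    by (rule braid_eq.append[OF twist_exchange
      braid_eq.append[OF braid_eq.sym[OF good_interchange[OF good]] tail_exchange]])
  have 5: "braid_eq 6 (shift_word 2 (twist_step w) @ cab 1 1 2 2 (twist_step w)) (shift_word 2 (twist_step w) @ ?K' @ ?C' @ ?Z')"
    using s by (intro braid_eq_appendL c) auto
  have 6: "braid_eq 6 ((shift_word 2 (twist_step w) @ ?K') @ ?C' @ ?Z') ((?K' @ twist_step w) @ ?C' @ ?Z')"
    using s C by (intro braid_eq_appendR slide_K24) auto
  have 7: "braid_eq 6 ((?K' @ ?X @ w) @ (?Y @ ?C') @ ?Z')
     ((?K' @ ?X @ w) @ (?C' @ [(False, 1), (False, 4)]) @ ?Z')"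
    using K X w6 by (intro braid_eq_context slide_cab) auto
  note L = braid_eq.trans[OF braid_eq.trans[OF 1 2[unfolded sh, unfolded append_assoc]]
      braid_eq.trans[OF 3[unfolded append_assoc] 4[unfolded append_assoc]]]
  note R = braid_eq.trans[OF braid_eq.trans[OF 5 6[unfolded sh, unfolded append_assoc]] 7[unfolded append_assoc]]
  show ?thesis by (rule braid_eq.trans[OF L braid_eq.sym[OF R]])
qed

text \<open>Both sides start with the same crossing \<open>?K\<close>. The negative crossing of
  ribbons that ends the first factor cancels against the start of the second, once the remaining
  letter 1 or 5 is moved out of the way.\<close>

lemma step_L':
  "braid_eq 6 (cab 1 2 1 2 (twist_step w) @ shift_word 2 (twist_step w)) (cab 2 1 2 1 (twist_step w) @ twist_step w)"
proof -
  note w = good_words[OF good] and perm = good_perm[OF good]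
  let ?K = "block True 1 3 3" and ?C = "cab 1 2 1 2 w" and ?C' = "cab 2 1 2 1 w"
  let ?Y = "[(False, 1), (False, 3), (False, 5)] :: braid_word"
  have C: "?C \<in> braid_words 6" "?C' \<in> braid_words 6" using w by (auto intro!: cab_words)
  have K: "?K \<in> braid_words 6" by (auto intro!: block_words)
  have w6: "w \<in> braid_words 6" "shift_word 2 w \<in> braid_words 6"
    using w braid_words_mono[OF w, of 6] shift_word_words[OF w, of 2 6] by auto
  have s: "twist_step w \<in> braid_words 6" "shift_word 2 (twist_step w) \<in> braid_words 6"
    using braid_words_mono[OF step_words, of 6] shift_word_words[OF step_words, of 2 6] by auto
  have Z: "block False 1 1 1 = [(False, 1)]" "block False (1 + 1 + 1) 2 2 = block False 3 2 2"
    "block False (1 + 2 + 2) 1 1 = [(False, 5)]"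
    by (simp_all add: block_def eval_nat_numeral)
  have n: "1 + 2 = (3::nat)" "2 + 1 = (3::nat)" by simp_all
  have c: "braid_eq 6 (cab 1 2 1 2 (twist_step w)) (?K @ ?C @ [(False, 1)] @ block False 3 2 2)"
    "braid_eq 6 (cab 2 1 2 1 (twist_step w)) (?K @ ?C' @ block False 1 2 2 @ [(False, 5)])"
    using cab_step[OF w perm, of 6 1 2 1 2, unfolded Z, unfolded n]
      cab_step[OF w perm, of 6 2 1 2 1, unfolded Z, unfolded n] by simp_all
  have b: "braid_eq 6 (block False 3 2 2 @ block True 3 2 2) []" "braid_eq 6 (block False 1 2 2 @ block True 1 2 2) []"
    using block_cancel[of 3 2 2 6 False] block_cancel[of 1 2 2 6 False] by simp_all
  have sh: "shift_word 2 (twist_step w) = block True 3 2 2 @ shift_word 2 w @ [(False, 3), (False, 5)]"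
    by (simp add: twist_step_def block_def eval_nat_numeral)
  have 1: "braid_eq 6 (cab 1 2 1 2 (twist_step w) @ shift_word 2 (twist_step w))
      ((?K @ ?C) @ (shift_word 2 w @ [(False, 1)]) @ [(False, 3), (False, 5)])"
  proof (rule braid_eq.trans)
    show "braid_eq 6 (cab 1 2 1 2 (twist_step w) @ shift_word 2 (twist_step w))
       ((?K @ ?C @ [(False, 1)] @ block False 3 2 2) @ shift_word 2 (twist_step w))"
      by (rule braid_eq_appendR[OF c(1) s(2)])
    have "braid_eq 6 ((?K @ ?C @ [(False, 1)]) @ (block False 3 2 2 @ block True 3 2 2) @ shift_word 2 w @ [(False, 3), (False, 5)])
      ((?K @ ?C @ [(False, 1)]) @ [] @ shift_word 2 w @ [(False, 3), (False, 5)])"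
      using K C w6 by (intro braid_eq_context b) auto
    moreover have "braid_eq 6 ((?K @ ?C) @ ([(False, 1)] @ shift_word 2 w) @ [(False, 3), (False, 5)])
      ((?K @ ?C) @ (shift_word 2 w @ [(False, 1)]) @ [(False, 3), (False, 5)])"
      using K C w by (intro braid_eq_context braid_eq.sym[OF slide_1]) auto
    ultimately show "braid_eq 6 ((?K @ ?C @ [(False, 1)] @ block False 3 2 2) @ shift_word 2 (twist_step w))
      ((?K @ ?C) @ (shift_word 2 w @ [(False, 1)]) @ [(False, 3), (False, 5)])"
      unfolding sh append_assoc append_Nil by (rule braid_eq.trans)
  qed
  have 2: "braid_eq 6 (cab 2 1 2 1 (twist_step w) @ twist_step w)
      ((?K @ ?C' @ w) @ ([(False, 5)] @ [(False, 1), (False, 3)]))"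
  proof (rule braid_eq.trans)
    show "braid_eq 6 (cab 2 1 2 1 (twist_step w) @ twist_step w)
       ((?K @ ?C' @ block False 1 2 2 @ [(False, 5)]) @ twist_step w)"
      by (rule braid_eq_appendR[OF c(2) s(1)])
    have X: "block True 1 2 2 @ w \<in> braid_words 4" using w by (auto intro!: block_words)
    have "braid_eq 6 ((?K @ ?C' @ block False 1 2 2) @ ([(False, 5)] @ block True 1 2 2 @ w) @ [(False, 1), (False, 3)])
      ((?K @ ?C' @ block False 1 2 2) @ ((block True 1 2 2 @ w) @ [(False, 5)]) @ [(False, 1), (False, 3)])"
      using K C by (intro braid_eq_context braid_eq.sym[OF slide_5[OF X]]) (auto intro!: block_words)
    moreover have "braid_eq 6 ((?K @ ?C') @ (block False 1 2 2 @ block True 1 2 2) @ w @ [(False, 5), (False, 1), (False, 3)])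
      ((?K @ ?C') @ [] @ w @ [(False, 5), (False, 1), (False, 3)])"
      using K C w6 by (intro braid_eq_context b) auto
    ultimately show "braid_eq 6 ((?K @ ?C' @ block False 1 2 2 @ [(False, 5)]) @ twist_step w)
      ((?K @ ?C' @ w) @ ([(False, 5)] @ [(False, 1), (False, 3)]))"
      unfolding twist_step_def append_assoc append_Nil append_Cons by (rule braid_eq.trans)
  qed
  have 3: "braid_eq 6 ([(False, 5)] @ [(False, 1), (False, 3)]) ([(False, 1), (False, 3)] @ [(False, 5)])"
    using letter_word_commute[of 5 6 "[(False, 1), (False, 3)]" False] by simp
  have "braid_eq 6 (?K @ (?C @ shift_word 2 w) @ ?Y) (?K @ (?C' @ w) @ ([(False, 5)] @ [(False, 1), (False, 3)]))"
    using braid_eq.append[OF good_interchange'[OF good] braid_eq.sym[OF 3]] K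
    by (intro braid_eq_appendL) simp_all
  from braid_eq.trans[OF braid_eq.trans[OF 1] braid_eq.sym[OF 2]] this show ?thesis by simp
qed

text \<open>The step exchanges the conditions for deleting \<open>(1,2)\<close> and
  \<open>(3,4)\<close>, and conjugates the other two trivial braids by a generator.\<close>

lemma step_unital:
  "braid_eq 2 (cab 0 0 1 1 (twist_step w)) []" "braid_eq 2 (cab 1 1 0 0 (twist_step w)) []"
  "braid_eq 2 (cab 0 1 0 1 (twist_step w)) []" "braid_eq 2 (cab 1 0 1 0 (twist_step w)) []"
proof -
  note w = good_words[OF good] and perm = good_perm[OF good]
  have u: "braid_eq 2 (cab 0 0 1 1 w) []" "braid_eq 2 (cab 1 1 0 0 w) []"
    "braid_eq 2 (cab 0 1 0 1 w) []" "braid_eq 2 (cab 1 0 1 0 w) []"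
    using good by (auto simp: good_word_def)
  have c: "braid_eq 2 [(True, Suc 0), (False, Suc 0)] []" using braid_eq.cancel[of 1 2 True] by simp
  show "braid_eq 2 (cab 0 0 1 1 (twist_step w)) []"
    using braid_eq.trans[OF cab_step[OF w perm, of 2 0 0 1 1]] u(2) by simp
  show "braid_eq 2 (cab 1 1 0 0 (twist_step w)) []"
    using braid_eq.trans[OF cab_step[OF w perm, of 2 1 1 0 0]] u(1) by simp
  have *: "braid_eq 2 ([(True, Suc 0)] @ v @ [(False, Suc 0)]) []" if "braid_eq 2 v []" for v
    using braid_eq.trans[OF braid_eq_context[OF that, of "[(True, Suc 0)]" "[(False, Suc 0)]"]] c by simp
  show "braid_eq 2 (cab 0 1 0 1 (twist_step w)) []"
    using braid_eq.trans[OF cab_step[OF w perm, of 2 0 1 0 1]] *[OF u(3)] by simp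
  show "braid_eq 2 (cab 1 0 1 0 (twist_step w)) []"
    using braid_eq.trans[OF cab_step[OF w perm, of 2 1 0 1 0]] *[OF u(4)] by simp
qed

lemma good_step: "good_word (twist_step w)"
  unfolding good_word_def
  using step_words step_perm step_L step_L' step_unital by blast

lemma step_exponents:
  "expo (cab 1 0 0 1 (twist_step w)) = 1 + expo (cab 0 1 1 0 w)"
  "expo (cab 0 1 1 0 (twist_step w)) = 1 + expo (cab 1 0 0 1 w)"
  using expo_cong[OF cab_step[OF good_words[OF good] good_perm[OF good], of 2 1 0 0 1]]
    expo_cong[OF cab_step[OF good_words[OF good] good_perm[OF good], of 2 0 1 1 0]]
  by (simp_all add: expo_block)

end

text \<open>Both interchange equations reduce to the commutation of the second and fourth
  generators.\<close>

lemma good_base: "good_word [(True, 2)]"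
proof -
  have f: "braid_eq 6 [(True, 4), (True, 2)] [(True, 2), (True, 4)]"
    "braid_eq 6 [(True, 2), (True, 4)] [(True, 4), (True, 2)]"
    using letters_commute[of 4 6 2 True] letters_commute[of 2 6 4 True] by simp_all
  have 1: "braid_eq 6 ([(True, 2), (True, 4)] @ [(True, 3)]) ([(True, 4), (True, 2)] @ [(True, 3)])"
    by (rule braid_eq_appendR[OF f(2)]) simp
  have 2: "braid_eq 6 ([(True, 3)] @ [(True, 2), (True, 4)]) ([(True, 3)] @ [(True, 4), (True, 2)])"
    by (rule braid_eq_appendL[OF f(2)]) simp
  have *: "cab a b c d [(True, 2)] = block True (1 + a) b c" for a b c d
    by (simp add: eval_nat_numeral mults_def)
  show ?thesis unfolding good_word_def *
    using 1 2 by (auto simp: block_def eval_nat_numeral intro: braid_eq.refl)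
qed

lemma good_mirror:
  assumes "good_word w" shows "good_word (mirror w)"
  using assms mirror_cong[OF good_interchange[OF assms]] mirror_cong[OF good_interchange'[OF assms]]
    mirror_cong[of 2 "cab 0 0 1 1 w" "[]"] mirror_cong[of 2 "cab 1 1 0 0 w" "[]"]
    mirror_cong[of 2 "cab 0 1 0 1 w" "[]"] mirror_cong[of 2 "cab 1 0 1 0 w" "[]"]
  unfolding good_word_def mirror_cable_word mirror_shift_word mirror_word_perm
  by simp

section \<open>Standard words and the classification\<close>

definition std_word :: "nat \<Rightarrow> braid_word" where
  "std_word n = (twist_step ^^ n) [(True, 2)]"

lemma good_std_word: "good_word (std_word n)"
  unfolding std_word_def by (induction n) (simp_all add: good_base good_step)

text \<open>The pairs \<open>(p, q)\<close> run through \<open>(0, 1)\<close>,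
  \<open>(2, 1)\<close>, \<open>(2, 3)\<close>, \<open>(4, 3)\<close> and so on.\<close>

lemma expo_std_word:
  "expo (cab 1 0 0 1 (std_word n)) = (if even n then int n else int n + 1)"
  "expo (cab 0 1 1 0 (std_word n)) = (if even n then int n + 1 else int n)"
proof (induction n)
  case 0
  have *: "cab a b c d [(True, 2)] = block True (1 + a) b c" for a b c d
    by (simp add: eval_nat_numeral mults_def)
  show "expo (cab 1 0 0 1 (std_word 0)) = (if even 0 then int 0 else int 0 + 1)"
    "expo (cab 0 1 1 0 (std_word 0)) = (if even 0 then int 0 + 1 else int 0)"
    unfolding std_word_def funpow.simps id_apply * by simp_all
next
  case (Suc n)
  have "std_word (Suc n) = twist_step (std_word n)" by (simp add: std_word_def)
  then show "expo (cab 1 0 0 1 (std_word (Suc n))) = (if even (Suc n) then int (Suc n) else int (Suc n) + 1)"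
    "expo (cab 0 1 1 0 (std_word (Suc n))) = (if even (Suc n) then int (Suc n) + 1 else int (Suc n))"
    using Suc step_exponents[OF good_std_word[of n]] by auto
qed

theorem good_classification:
  assumes "good_word w"
  shows "\<exists>n. braid_eq 4 w (std_word n) \<or> braid_eq 4 w (mirror (std_word n))"
proof -
  define p where "p = expo (cab 1 0 0 1 w)"
  define q where "q = expo (cab 0 1 1 0 w)"
  have pq: "even p" "odd q" "\<bar>p - q\<bar> = 1"
    using good_parity[OF assms] good_exponents[OF assms] by (simp_all add: p_def q_def)
  have std: "braid_eq 4 w (std_word n)" if "p = (if even n then int n else int n + 1)"
      "q = (if even n then int n + 1 else int n)" for n
    using that by (intro good_unique assms good_std_word) (simp_all only: expo_std_word p_def[symmetric] q_def[symmetric])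
  have mir: "braid_eq 4 w (mirror (std_word n))" if "p = - (if even n then int n else int n + 1)"
      "q = - (if even n then int n + 1 else int n)" for n
    using that by (intro good_unique assms good_mirror good_std_word)
      (simp_all only: mirror_cable_word expo_mirror expo_std_word p_def[symmetric] q_def[symmetric])
  \<comment> \<open>In each case \<open>n\<close> is the smaller of the absolute values of
    \<open>p\<close> and \<open>q\<close>. Its parity selects the right branch, since
    \<open>p\<close> is even and \<open>q\<close> is odd.\<close>
  consider "q = p + 1" "0 \<le> p" | "q = p + 1" "p < 0" | "p = q + 1" "0 \<le> q" | "p = q + 1" "q < 0"
    using pq(3) by linarith
  then show ?thesis
  proof cases
    case 1
    then have "braid_eq 4 w (std_word (nat p))" using pq by (intro std) (simp_all add: even_nat_iff)
    then show ?thesis by blast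
  next
    case 2
    then have "braid_eq 4 w (mirror (std_word (nat (- q))))" using pq by (intro mir) (simp_all add: even_nat_iff)
    then show ?thesis by blast
  next
    case 3
    then have "braid_eq 4 w (std_word (nat q))" using pq by (intro std) (simp_all add: even_nat_iff)
    then show ?thesis by blast
  next
    case 4
    then have "braid_eq 4 w (mirror (std_word (nat (- p))))" using pq by (intro mir) (simp_all add: even_nat_iff)
    then show ?thesis by blast
  qed
qed

section \<open>Standard words as products of powers in the braid group\<close>

lemma (in group) int_pow_conj_Suc:
  assumes "x \<in> carrier G" "t \<in> carrier G" "y \<in> carrier G"
  shows "x [^] (e * int (Suc n)) \<otimes> t \<otimes> y [^] (- (e * int (Suc n)))
    = x [^] e \<otimes> (x [^] (e * int n) \<otimes> t \<otimes> y [^] (- (e * int n))) \<otimes> y [^] (- e)"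
proof -
  \<comment> \<open>One factor is split off at the outer end on each side, as in
    \<open>twist_step\<close>.\<close>
  have e: "e * int (Suc n) = e + e * int n" "- (e * int (Suc n)) = - (e * int n) + - e"
    by (simp_all add: algebra_simps)
  show ?thesis unfolding e(2) unfolding e(1) using assms by (simp only: int_pow_mult m_assoc int_pow_closed m_closed)
qed

lemma inv_braid_class:
  assumes "w \<in> braid_words n"
  shows "inv\<^bsub>braid_group n\<^esub> (braid_class n w) = braid_class n (inv_word w)"
proof -
  interpret group "braid_group n" by (rule braid_group_group)
  show ?thesis
    using assms by (intro inv_equality)
      (auto simp: braid_group_simps braid_mult_class braid_class_eq_iff inv_word_left)
qed

lemma std_braid_class:
  "std_braid 1 n = braid_class 4 (std_word n)" "std_braid (- 1) n = braid_class 4 (mirror (std_word n))"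
proof -
  interpret group "braid_group 4" by (rule braid_group_group)
  define x where "x = sigma 4 2 \<otimes>\<^bsub>braid_group 4\<^esub> sigma 4 1 \<otimes>\<^bsub>braid_group 4\<^esub> sigma 4 3 \<otimes>\<^bsub>braid_group 4\<^esub> sigma 4 2"
  define y where "y = sigma 4 1 \<otimes>\<^bsub>braid_group 4\<^esub> sigma 4 3"
  define t where "t = sigma 4 2"
  have std: "std_braid e n = x [^]\<^bsub>braid_group 4\<^esub> (e * int n) \<otimes>\<^bsub>braid_group 4\<^esub> (t [^]\<^bsub>braid_group 4\<^esub> e)
      \<otimes>\<^bsub>braid_group 4\<^esub> y [^]\<^bsub>braid_group 4\<^esub> (- (e * int n))" for e n
    by (simp add: std_braid_def x_def y_def t_def Let_def)
  have X: "x = braid_class 4 [(True, 2), (True, 1), (True, 3), (True, 2)]"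
    and Y: "y = braid_class 4 [(True, 1), (True, 3)]" and T: "t = braid_class 4 [(True, 2)]"
    by (simp_all add: x_def y_def t_def sigma_def braid_mult_class)
  have carr: "x \<in> carrier (braid_group 4)" "y \<in> carrier (braid_group 4)" "t \<in> carrier (braid_group 4)"
    unfolding X Y T braid_group_simps by auto
  have inv: "inv\<^bsub>braid_group 4\<^esub> x = braid_class 4 (block False 1 2 2)"
    "inv\<^bsub>braid_group 4\<^esub> y = braid_class 4 [(False, 3), (False, 1)]"
    "inv\<^bsub>braid_group 4\<^esub> t = braid_class 4 [(False, 2)]"
    unfolding X Y T twist_block by (subst inv_braid_class; simp)+
  \<comment> \<open>Commuting the letters 1 and 3 turns the given factor into the word of
    \<open>block True 1 2 2\<close>.\<close>
  have "braid_eq 4 ([(True, 2)] @ [(True, 1), (True, 3)] @ [(True, 2)]) ([(True, 2)] @ [(True, 3), (True, 1)] @ [(True, 2)])"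
    using letters_commute[of 1 4 3 True] by (intro braid_eq_context) simp_all
  then have X2: "x = braid_class 4 (block True 1 2 2)"
    unfolding X twist_block by (subst braid_class_eq_iff) simp_all
  have Y2: "inv\<^bsub>braid_group 4\<^esub> y = braid_class 4 [(False, 1), (False, 3)]"
    using letters_commute[of 3 4 1 False] unfolding inv by (subst braid_class_eq_iff) simp_all
  have b: "block s 1 2 2 \<in> braid_words 4" for s by (rule block_words) simp_all
  have w: "std_word n \<in> braid_words 4" for n by (rule good_words[OF good_std_word])
  have std_Suc: "std_word (Suc n) = block True 1 2 2 @ std_word n @ [(False, 1), (False, 3)]"
    "mirror (std_word (Suc n)) = block False 1 2 2 @ mirror (std_word n) @ [(True, 1), (True, 3)]" for n
    by (simp_all add: std_word_def twist_step_def mirror_block)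
  show "std_braid 1 n = braid_class 4 (std_word n)"
  proof (induction n)
    case 0 show ?case using carr by (simp add: std T std_word_def int_pow_1)
  next
    case (Suc n)
    have "std_braid 1 (Suc n) = x \<otimes>\<^bsub>braid_group 4\<^esub> braid_class 4 (std_word n) \<otimes>\<^bsub>braid_group 4\<^esub> inv\<^bsub>braid_group 4\<^esub> y"
      unfolding Suc.IH[symmetric] std using carr by (subst int_pow_conj_Suc) (simp_all add: int_pow_1 int_pow_neg)
    then show ?case using w[of n] b[of True] unfolding X2 Y2 std_Suc(1) by (simp add: braid_mult_class)
  qed
  show "std_braid (- 1) n = braid_class 4 (mirror (std_word n))"
  proof (induction n)
    case 0 show ?case using carr inv_closed[OF carr(3), unfolded inv]
      by (simp add: std inv std_word_def int_pow_1 int_pow_neg)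
  next
    case (Suc n)
    have "std_braid (- 1) (Suc n) = inv\<^bsub>braid_group 4\<^esub> x \<otimes>\<^bsub>braid_group 4\<^esub> braid_class 4 (mirror (std_word n)) \<otimes>\<^bsub>braid_group 4\<^esub> y"
      unfolding Suc.IH[symmetric] std using carr by (subst int_pow_conj_Suc) (simp_all add: int_pow_1 int_pow_neg)
    then show ?case using w[of n] b[of False] unfolding inv Y std_Suc(2) by (simp add: braid_mult_class)
  qed
qed

theorem theorem3p6:
  fixes b :: "braid_word set"
  assumes "b \<in> carrier (braid_group 4)"
  shows "interchanging_unital b \<longleftrightarrow>
    (\<exists>n::nat. b = std_braid 1 n \<or> b = std_braid (-1) n)"
proof
  obtain w where w: "w \<in> braid_words 4" and b: "b = braid_class 4 w"
    using assms by (auto simp: braid_group_simps)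
  assume "interchanging_unital b"
  then have "good_word w" using w b by (simp add: interchanging_unital_class)
  then show "\<exists>n. b = std_braid 1 n \<or> b = std_braid (- 1) n"
    using good_classification[of w] w unfolding b std_braid_class by (simp add: braid_class_eq_iff)
next
  assume "\<exists>n. b = std_braid 1 n \<or> b = std_braid (- 1) n"
  then obtain w where "good_word w" "b = braid_class 4 w"
    unfolding std_braid_class using good_std_word good_mirror by blast
  then show "interchanging_unital b" by (simp add: interchanging_unital_class good_words)
qed

end
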